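(* If $G$ and $H$ are $(e)$-positive labelled graphs, then the concatenation $G+H^r$ is $e$-positive.
   Context: All graphs are finite and simple with nonempty vertex set. A labelled graph on $d$ vertices is a graph with vertex set $[d]=\{1,\dots,d\}$. The reverse graph $H^r$ of a labelled graph $H$ on $d$ vertices is obtained by relabelling each vertex $i$ as $d+1-i$. For labelled graphs $G$ on $n$ vertices and $H$ on $m$ vertices, the concatenation $G+H$ is the labelled graph on $[n+m-1]$ obtained by placing $G$ on labels $1,\dots,n$ and $H$ on labels $n,\dots,n+m-1$ (vertex $i$ of $H$ becoming $n-1+i$), so vertex $n$ of $G$ is identified with vertex $1$ of $H$. The chromatic symmetric function is $X_G=\sum_\kappa\prod_{v\in V(G)}x_{\kappa(v)}$ (commuting variables), summed over all proper colourings $\kappa:V(G)\to\mathbb Z_{>0}$. With $e_i=\sum_{j_1<\cdots<j_i}x_{j_1}\cdots x_{j_i}$ and $e_\lambda=\prod_i e_{\lambda_i}$, $G$ is $e$-positive if $X_G$ expands in the basis $\{e_\lambda\}$ of symmetric functions over $\mathbb Q$ with all coefficients nonnegative. For a set partition $\pi$ of $[d]$, let $B_{\pi,i}$ be the block containing $i$, and let $e_\pi=\sum x_{i_1}\cdots x_{i_d}$ in noncommuting variables $x_1,x_2,\dots$, summed over all tuples $(i_1,\dots,i_d)$ of positive integers with $i_j\ne i_k$ whenever $j\neq k$ and $B_{\pi,j}=B_{\pi,k}$. The $e_\pi$, over set partitions $\pi$ of $[d]$, form a $\mathbb Q$-basis of $\mathrm{NCSym}^d$, the degree-$d$ part of the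 algebra of symmetric functions in noncommuting variables. For $d\ge 1$ let $\mathrm{type}(\pi)=(\lambda,b)$, where $b=|B_{\pi,d}|$ and $\lambda$ is the integer partition (possibly empty) formed by the sizes of the other blocks. $\mathrm{UBCSym}^d$ is the $\mathbb Q$-vector space with basis $\{e_{(\lambda,b)}\}$ over pairs of a partition $\lambda$ and an integer $b\ge 1$ with $|\lambda|+b=d$, and $\nu:\mathrm{NCSym}^d\to\mathrm{UBCSym}^d$ is the linear map with $\nu(e_\pi)=e_{\mathrm{type}(\pi)}$. For a labelled graph $G$ on $d$ vertices, $Y_G=\sum_\kappa x_{\kappa(1)}\cdots x_{\kappa(d)}\in\mathrm{NCSym}^d$, summed over all proper colourings $\kappa:[d]\to\mathbb Z_{>0}$ of $G$, and $y_G=\nu(Y_G)$. $G$ is $(e)$-positive if all coefficients of $y_G$ in the basis $\{e_{(\lambda,b)}\}$ are nonnegative. *)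

theory Defs
  imports
    "HOL-Library.Multiset"
    "HOL-Library.FuncSet"
    "HOL-Library.Disjoint_Sets"
    "HOL-Library.Function_Algebras"
    "HOL-Library.Poly_Mapping"
    Complex_Main
begin

record 'a ugraph =
  verts :: "'a set"
  edges :: "'a set set"

definition graph :: "'a ugraph \<Rightarrow> bool" where
  "graph G \<longleftrightarrow> finite (verts G) \<and> verts G \<noteq> {} \<and> (\<forall>e\<in>edges G. e \<subseteq> verts G \<and> card e = 2)"

definition labelled_graph :: "nat \<Rightarrow> nat ugraph \<Rightarrow> bool" where
  "labelled_graph d G \<longleftrightarrow> graph G \<and> verts G = {1..d}"

definition reverse_graph :: "nat ugraph \<Rightarrow> nat ugraph" where
  "reverse_graph H =
     (let d = card (verts H); r = (\<lambda>i. d + 1 - i)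
      in \<lparr>verts = r ` verts H, edges = (\<lambda>e. r ` e) ` edges H\<rparr>)"

definition concat_graph :: "nat ugraph \<Rightarrow> nat ugraph \<Rightarrow> nat ugraph" where
  "concat_graph G H =
     (let n = card (verts G); m = card (verts H)
      in \<lparr>verts = {1..n + m - 1},
          edges = edges G \<union> (\<lambda>e. (\<lambda>i. n - 1 + i) ` e) ` edges H\<rparr>)"

definition proper_colourings :: "'a ugraph \<Rightarrow> ('a \<Rightarrow> nat) set" where
  "proper_colourings G =
     {\<kappa> \<in> verts G \<rightarrow>\<^sub>E {1..}. \<forall>u\<in>verts G. \<forall>v\<in>verts G. {u, v} \<in> edges G \<longrightarrow> \<kappa> u \<noteq> \<kappa> v}"

text \<open>
  The ring of formal power series with rational coefficients in countably many commuting variables;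
  a monomial is represented by the multiset of the indices of its variables.
\<close>

typedef mseries = "UNIV :: (nat multiset \<Rightarrow> rat) set"
  morphisms mcoeff Abs_mseries ..

setup_lifting type_definition_mseries

lemma mseries_eqI: "(\<And>M. mcoeff f M = mcoeff g M) \<Longrightarrow> f = g"
  by transfer auto

lemma finite_mset_splits: "finite {(A, B). A + B = (M :: 'a multiset)}"
proof (rule finite_subset)
  let ?L = "{xs. set xs \<subseteq> set_mset M \<and> length xs \<le> size M}"
  have "A \<in> mset ` ?L" if "A \<subseteq># M" for A
  proof -
    obtain xs where "mset xs = A" using ex_mset by blast
    with that show ?thesis
      by (metis (mono_tags, lifting) image_eqI mem_Collect_eq set_mset_mono set_mset_mset size_mset
          size_mset_mono)
  qed
  then show "{(A, B). A + B = M} \<subseteq> mset ` ?L \<times> mset ` ?L"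
    using mset_subset_eq_add_left mset_subset_eq_add_right by blast
  show "finite (mset ` ?L \<times> mset ` ?L)"
    by (intro finite_cartesian_product finite_imageI finite_lists_length_le) auto
qed

instantiation mseries :: comm_ring_1
begin

lift_definition zero_mseries :: mseries is "\<lambda>_. 0" .
lift_definition one_mseries :: mseries is "\<lambda>M. if M = {#} then 1 else 0" .
lift_definition plus_mseries :: "mseries \<Rightarrow> mseries \<Rightarrow> mseries" is "\<lambda>f g M. f M + g M" .
lift_definition minus_mseries :: "mseries \<Rightarrow> mseries \<Rightarrow> mseries" is "\<lambda>f g M. f M - g M" .
lift_definition uminus_mseries :: "mseries \<Rightarrow> mseries" is "\<lambda>f M. - f M" .
lift_definition times_mseries :: "mseries \<Rightarrow> mseries \<Rightarrow> mseries"
  is "\<lambda>f g M. \<Sum>(A, B) | A + B = M. f A * g B" .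

instance
proof
  fix f g h :: mseries
  show "f * g = g * f"
    by transfer
       (auto intro!: ext sum.reindex_bij_witness[where i = prod.swap and j = prod.swap]
             simp: add.commute mult.commute)
  show "f * g * h = f * (g * h)"
  proof (transfer, rule ext)
    fix f g h :: "nat multiset \<Rightarrow> rat" and M
    have "(\<Sum>(A, B) | A + B = M. (\<Sum>(C, D) | C + D = A. f C * g D) * h B) =
          (\<Sum>(P, Q) \<in> Sigma {(A, B). A + B = M} (\<lambda>(A, B). {(C, D). C + D = A}).
             f (fst Q) * g (snd Q) * h (snd P))"
      by (subst sum.Sigma[symmetric])
         (auto simp: finite_mset_splits finite_mset_splits[unfolded case_prod_unfold] sum_distrib_right case_prod_unfold intro!: sum.cong)
    also have "\<dots> =
          (\<Sum>(P, Q) \<in> Sigma {(A, B). A + B = M} (\<lambda>(A, B). {(C, D). C + D = B}).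
             f (fst P) * (g (fst Q) * h (snd Q)))"
      by (rule sum.reindex_bij_witness
          [where i = "\<lambda>((A, B), (C, D)). ((A + C, D), (A, C))"
             and j = "\<lambda>((A, B), (C, D)). ((C, D + B), (D, B))"])
         (auto simp: add.assoc mult.assoc)
    also have "\<dots> = (\<Sum>(A, B) | A + B = M. f A * (\<Sum>(C, D) | C + D = B. g C * h D))"
      by (subst sum.Sigma[symmetric])
         (auto simp: finite_mset_splits finite_mset_splits[unfolded case_prod_unfold] sum_distrib_left case_prod_unfold intro!: sum.cong)
    finally show "(\<Sum>(A, B) | A + B = M. (\<Sum>(C, D) | C + D = A. f C * g D) * h B) =
                  (\<Sum>(A, B) | A + B = M. f A * (\<Sum>(C, D) | C + D = B. g C * h D))" .
  qed
  show "1 * f = f"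
  proof (transfer, rule ext)
    fix f :: "nat multiset \<Rightarrow> rat" and M
    have "(\<Sum>(A, B) | A + B = M. (if A = {#} then 1 else 0) * f B) =
          (\<Sum>(A, B) \<in> {({#} :: nat multiset, M)}. (if A = {#} then 1 else 0) * f B)"
      by (rule sum.mono_neutral_right) (auto simp: finite_mset_splits split: if_splits)
    then show "(\<Sum>(A, B) | A + B = M. (if A = {#} then 1 else 0) * f B) = f M" by simp
  qed
  show "(f + g) * h = f * h + g * h"
    by transfer (auto simp: fun_eq_iff sum.distrib[symmetric] distrib_right intro!: sum.cong)
  show "(0 :: mseries) \<noteq> 1"
    by transfer (metis zero_neq_one)
qed (transfer; auto simp: fun_eq_iff)+

end

lift_definition mscale :: "rat \<Rightarrow> mseries \<Rightarrow> mseries" is "\<lambda>c f M. c * f M" .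

lift_definition elem_sym :: "nat \<Rightarrow> mseries"
  is "\<lambda>i M. of_nat (card {S. S \<subseteq> {1..} \<and> finite S \<and> card S = i \<and> mset_set S = M})" .

definition elem_sym_part :: "nat multiset \<Rightarrow> mseries" where
  "elem_sym_part p = (\<Prod>i\<in>#p. elem_sym i)"

lift_definition chromatic_sym :: "'a ugraph \<Rightarrow> mseries"
  is "\<lambda>G M. of_nat (card {\<kappa> \<in> proper_colourings G. image_mset \<kappa> (mset_set (verts G)) = M})" .

text \<open>Integer partitions are multisets of positive integers.\<close>

definition e_positive :: "'a ugraph \<Rightarrow> bool" where
  "e_positive G \<longleftrightarrow>
     (\<exists>c :: nat multiset \<Rightarrow>\<^sub>0 rat.
        (\<forall>p\<in>Poly_Mapping.keys c. 0 \<notin># p) \<and>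
        chromatic_sym G = (\<Sum>p\<in>Poly_Mapping.keys c. mscale (Poly_Mapping.lookup c p) (elem_sym_part p)) \<and>
        (\<forall>p. Poly_Mapping.lookup c p \<ge> 0))"

text \<open>
  A formal power series in the noncommuting variables is the function sending a word to its
  coefficient, where a word lists the variable indices of a monomial in order.
\<close>

type_synonym ncseries = "nat list \<Rightarrow> rat"

definition ncscale :: "rat \<Rightarrow> ncseries \<Rightarrow> ncseries" where
  "ncscale c f = (\<lambda>w. c * f w)"

global_interpretation nc: vector_space ncscale
  by standard (auto simp: ncscale_def fun_eq_iff algebra_simps)

text \<open>The sum of the words \<open>i 1, \<dots>, i d\<close> over all tuples \<open>i\<close> in \<open>T\<close>.\<close>

definition word_sum :: "nat \<Rightarrow> (nat \<Rightarrow> nat) set \<Rightarrow> ncseries" where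
  "word_sum d T = (\<lambda>w. of_nat (card {i \<in> T. map i [1..<d + 1] = w}))"

definition block :: "nat set set \<Rightarrow> nat \<Rightarrow> nat set" where
  "block \<pi> i = (THE B. B \<in> \<pi> \<and> i \<in> B)"

definition nc_elem :: "nat \<Rightarrow> nat set set \<Rightarrow> ncseries" where
  "nc_elem d \<pi> =
     word_sum d {i \<in> {1..d} \<rightarrow>\<^sub>E {1..}.
       \<forall>j\<in>{1..d}. \<forall>k\<in>{1..d}. j \<noteq> k \<and> block \<pi> j = block \<pi> k \<longrightarrow> i j \<noteq> i k}"

definition partition_type :: "nat \<Rightarrow> nat set set \<Rightarrow> nat multiset \<times> nat" where
  "partition_type d \<pi> =
     (image_mset card (mset_set (\<pi> - {block \<pi> d})), card (block \<pi> d))"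

text \<open>
  The elements of \<open>UBCSym\<^sup>d\<close> are represented as finitely supported functions on pairs \<open>(p, b)\<close>,
  so that \<open>Poly_Mapping.single (p, b) c\<close> is \<open>c\<close> times the basis element indexed by \<open>(p, b)\<close>.
  The coefficient of the series \<open>f\<close> at a basis element is taken from \<^const>\<open>nc.representation\<close>, which
  has its intended meaning for \<open>f \<in> NCSym\<^sup>d\<close> (the span of the \<open>nc_elem d \<pi>\<close>) because
  the \<open>nc_elem d \<pi>\<close> are pairwise different and linearly independent.
\<close>

definition nu :: "nat \<Rightarrow> ncseries \<Rightarrow> (nat multiset \<times> nat) \<Rightarrow>\<^sub>0 rat" where
  "nu d f =
     (\<Sum>\<pi> | partition_on {1..d} \<pi>.
        Poly_Mapping.single (partition_type d \<pi>)
          (nc.representation (nc_elem d ` {\<sigma>. partition_on {1..d} \<sigma>}) f (nc_elem d \<pi>)))"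

definition chromatic_nc :: "nat \<Rightarrow> nat ugraph \<Rightarrow> ncseries" where
  "chromatic_nc d G = word_sum d (proper_colourings G)"

definition paren_e_positive :: "nat \<Rightarrow> nat ugraph \<Rightarrow> bool" where
  "paren_e_positive d G \<longleftrightarrow> (\<forall>k. Poly_Mapping.lookup (nu d (chromatic_nc d G)) k \<ge> 0)"

end

theory Submission
  imports Defs
begin

text \<open>
  Newton's identity in noncommuting variables shows that the \<open>e\<^sub>\<pi>\<close> span the indicator series of any system
  of equations and inequations between colours. These include as many linearly independent series as
  there are set partitions, so the \<open>e\<^sub>\<pi>\<close> are a basis, and being a proper colouring of \<open>G\<close> is a linear
  combination, pointwise in the colouring, of the conditions ``injective on every block of \<open>\<pi>\<close>''. Hence
  the chromatic symmetric function of \<open>G + H\<^sup>r\<close> is bilinear in the coefficients of \<open>G\<close> and \<open>H\<close>, and the series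
  attached to \<open>\<pi>\<close> and \<open>\<rho>\<close> is the chromatic symmetric function of a disjoint union of cliques
  and of two cliques glued at a vertex. It depends only on the types, so it remains to see that two
  cliques glued at a vertex are e-positive. With \<open>W a b\<close> for the series of two cliques on \<open>a + 1\<close> and \<open>b + 1\<close>
  vertices and \<open>E k = k! e\<^sub>k\<close>, this follows by induction on \<open>b\<close> from
  \<open>(a + 1) W a b = b W (a + 1) (b - 1) + (a + 1 - b) E (a + 1) E b\<close> for \<open>b \<le> a + 1\<close>.
\<close>

section \<open>A basis of NCSym\<close>

lemma block_eq: "partition_on A \<pi> \<Longrightarrow> B \<in> \<pi> \<Longrightarrow> i \<in> B \<Longrightarrow> block \<pi> i = B"
  unfolding block_def partition_on_def disjoint_def by (rule the_equality) blast+

lemma block_in: "partition_on A \<pi> \<Longrightarrow> i \<in> A \<Longrightarrow> block \<pi> i \<in> \<pi>"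
  and in_block: "partition_on A \<pi> \<Longrightarrow> i \<in> A \<Longrightarrow> i \<in> block \<pi> i"
  using block_eq[of A \<pi>] unfolding partition_on_def by fastforce+

lemma inj_on_blocks_iff:
  assumes "partition_on A \<pi>"
  shows "(\<forall>j\<in>A. \<forall>k\<in>A. j \<noteq> k \<and> block \<pi> j = block \<pi> k \<longrightarrow> \<kappa> j \<noteq> \<kappa> k) \<longleftrightarrow> (\<forall>B\<in>\<pi>. inj_on \<kappa> B)"
    (is "?L \<longleftrightarrow> ?R")
proof
  assume ?L
  have "\<kappa> j \<noteq> \<kappa> k" if "B \<in> \<pi>" "j \<in> B" "k \<in> B" "j \<noteq> k" for B j k
  proof -
    have "j \<in> A" "k \<in> A"
      using that assms by (auto simp: partition_on_def)
    then show ?thesis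
      using that \<open>?L\<close> block_eq[OF assms \<open>B \<in> \<pi>\<close>] by simp
  qed
  then show ?R
    unfolding inj_on_def by blast
next
  assume R: ?R
  show ?L
  proof (intro ballI impI)
    fix j k assume "j \<in> A" "k \<in> A" "j \<noteq> k \<and> block \<pi> j = block \<pi> k"
    with R block_in[OF assms] in_block[OF assms] show "\<kappa> j \<noteq> \<kappa> k"
      by (metis inj_on_def)
  qed
qed

section \<open>Series of weighted colourings in noncommuting variables\<close>

definition constant_on_set :: "('a \<Rightarrow> 'b) \<Rightarrow> 'a set \<Rightarrow> bool" where
  "constant_on_set \<kappa> B \<longleftrightarrow> (\<forall>x\<in>B. \<forall>y\<in>B. \<kappa> x = \<kappa> y)"

text \<open>The sum of \<open>f \<kappa>\<close> times the word of colours of \<kappa>: a word of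
  length \<open>d\<close> in positive letters is a colouring of [d], with list positions counted
  from 0 and labels from 1. Since \<open>series_of\<close> is linear, identities that hold for each
  colouring become identities of series.\<close>

definition series_of :: "nat \<Rightarrow> ((nat \<Rightarrow> nat) \<Rightarrow> rat) \<Rightarrow> ncseries" where
  "series_of d f = (\<lambda>w. if length w = d \<and> set w \<subseteq> {1..} then f (\<lambda>i\<in>{1..d}. w ! (i - 1)) else 0)"

lemma word_fun_in:
  "length w = d \<Longrightarrow> set w \<subseteq> {1..} \<Longrightarrow> (\<lambda>i\<in>{1..d}. w ! (i - 1)) \<in> {1..d} \<rightarrow>\<^sub>E {1..}"
proof (intro PiE_I)
  fix i assume w: "length w = d" "set w \<subseteq> {1..}" and i: "i \<in> {1..d}"
  then have "w ! (i - 1) \<in> set w" by (intro nth_mem) auto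
  with w i show "(\<lambda>i\<in>{1..d}. w ! (i - 1)) i \<in> {1..}" by auto
qed auto

lemma series_of_cong:
  "(\<And>\<kappa>. \<kappa> \<in> {1..d} \<rightarrow>\<^sub>E {1..} \<Longrightarrow> f \<kappa> = g \<kappa>) \<Longrightarrow> series_of d f = series_of d g"
  unfolding series_of_def by (rule ext) (metis word_fun_in)

lemma word_of_fun:
  assumes "\<kappa> \<in> {1..d} \<rightarrow>\<^sub>E {1..}"
  shows "length (map \<kappa> [1..<d + 1]) = d" "set (map \<kappa> [1..<d + 1]) \<subseteq> {1..}"
    "(\<lambda>i\<in>{1..d}. map \<kappa> [1..<d + 1] ! (i - 1)) = \<kappa>"
  subgoal by simp
  subgoal using assms by fastforce
  subgoal using assms by (intro ext) (auto simp: PiE_def extensional_def nth_map_upt simp del: upt_Suc map_upt_Suc)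
  done

lemma series_of_word:
  "\<kappa> \<in> {1..d} \<rightarrow>\<^sub>E {1..} \<Longrightarrow> series_of d f (map \<kappa> [1..<d + 1]) = f \<kappa>"
  unfolding series_of_def using word_of_fun[of \<kappa> d] by (simp del: map_upt_Suc upt_Suc)

text \<open>At most one extensional colouring spells a given word, so every cardinality in
  \<open>word_sum\<close> is 0 or 1.\<close>

lemma word_sum_eq_series_of:
  "word_sum d {\<kappa> \<in> {1..d} \<rightarrow>\<^sub>E {1..}. P \<kappa>} = series_of d (\<lambda>\<kappa>. of_bool (P \<kappa>))"
proof
  fix w :: "nat list"
  let ?k = "\<lambda>i\<in>{1..d}. w ! (i - 1)"
  show "word_sum d {\<kappa> \<in> {1..d} \<rightarrow>\<^sub>E {1..}. P \<kappa>} w = series_of d (\<lambda>\<kappa>. of_bool (P \<kappa>)) w"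
  proof (cases "length w = d \<and> set w \<subseteq> {1..}")
    case True
    have m: "map ?k [1..<d + 1] = w"
      using True by (intro nth_equalityI) (auto simp del: upt_Suc)
    have "{\<kappa> \<in> {\<kappa> \<in> {1..d} \<rightarrow>\<^sub>E {1..}. P \<kappa>}. map \<kappa> [1..<d + 1] = w} = (if P ?k then {?k} else {})"
    proof -
      have "\<kappa> = ?k" if "\<kappa> \<in> {1..d} \<rightarrow>\<^sub>E {1..}" "map \<kappa> [1..<d + 1] = w" for \<kappa>
        using word_of_fun(3)[OF that(1)] that(2) by metis
      moreover have "?k \<in> {1..d} \<rightarrow>\<^sub>E {1..}"
        using True by (intro word_fun_in) auto
      ultimately show ?thesis
        using m by (auto simp del: upt_Suc map_upt_Suc One_nat_def)
    qed
    then show ?thesis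
      using True by (simp add: word_sum_def series_of_def)
  next
    case False
    then have "{\<kappa> \<in> {\<kappa> \<in> {1..d} \<rightarrow>\<^sub>E {1..}. P \<kappa>}. map \<kappa> [1..<d + 1] = w} = {}"
      using word_of_fun(1,2)[of _ d] by blast
    then show ?thesis
      unfolding word_sum_def series_of_def using False by (metis card.empty of_nat_0)
  qed
qed

lemma nc_elem_eq:
  "partition_on {1..d} \<pi> \<Longrightarrow> nc_elem d \<pi> = series_of d (\<lambda>\<kappa>. of_bool (\<forall>B\<in>\<pi>. inj_on \<kappa> B))"
  unfolding nc_elem_def by (subst inj_on_blocks_iff) (auto simp: word_sum_eq_series_of simp del: One_nat_def)

lemma series_of_add: "series_of d (\<lambda>\<kappa>. f \<kappa> + g \<kappa>) = series_of d f + series_of d g"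
  and series_of_diff: "series_of d (\<lambda>\<kappa>. f \<kappa> - g \<kappa>) = series_of d f - series_of d g"
  and series_of_scale: "series_of d (\<lambda>\<kappa>. c * f \<kappa>) = ncscale c (series_of d f)"
  by (auto simp: series_of_def fun_eq_iff ncscale_def)

lemma series_of_sum: "series_of d (\<lambda>\<kappa>. \<Sum>i\<in>I. f i \<kappa>) = (\<Sum>i\<in>I. series_of d (f i))"
proof (induction I rule: infinite_finite_induct)
  case (insert x F)
  then show ?case by (simp add: series_of_add)
qed (auto simp: series_of_def fun_eq_iff)

text \<open>A noncommutative form of Newton's identity, k e_k = sum of (-1)^(i+1) p_i e_(k-i):
  constancy on \<open>I\<close> stands for p_i and injectivity on \<open>B - I\<close> for (k-i)!
  e_(k-i), and \<open>fact (card I)\<close> balances the number of sets \<open>I\<close> of each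
  size. For injective \<kappa> only singletons contribute, 1 each; otherwise nonzero terms can only
  come from a single colour class, and they cancel.\<close>

lemma newton_pointwise:
  fixes \<kappa> :: "'a \<Rightarrow> 'b"
  assumes fin: "finite B"
  shows "(\<Sum>I\<in>Pow B - {{}}. (-1) ^ (card I + 1) * fact (card I) *
           of_bool (constant_on_set \<kappa> I \<and> inj_on \<kappa> (B - I))) = (of_nat (card B) * of_bool (inj_on \<kappa> B) :: rat)"
    (is "(\<Sum>I\<in>?P. ?t I) = _")
proof (cases "inj_on \<kappa> B")
  case True
  have "(\<Sum>I\<in>?P. ?t I) = (\<Sum>I\<in>(\<lambda>x. {x}) ` B. ?t I)"
  proof (rule sum.mono_neutral_right)
    show "\<forall>I\<in>?P - (\<lambda>x. {x}) ` B. ?t I = 0"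
    proof
      fix I assume I: "I \<in> ?P - (\<lambda>x. {x}) ` B"
      then obtain x where "x \<in> I" "x \<in> B" "I \<subseteq> B" by blast
      with I obtain y where "y \<in> I" "y \<noteq> x" by blast
      with True \<open>x \<in> I\<close> \<open>I \<subseteq> B\<close> have "\<not> constant_on_set \<kappa> I"
        unfolding constant_on_set_def inj_on_def by blast
      then show "?t I = 0" by simp
    qed
  qed (use fin in auto)
  also have "\<dots> = (\<Sum>x\<in>B. ?t {x})"
    by (subst sum.reindex) auto
  also have "\<dots> = (\<Sum>x\<in>B. 1)"
    using True by (intro sum.cong) (auto simp: constant_on_set_def intro: inj_on_subset)
  finally show ?thesis using True by simp
next
  case False
  then obtain x y where xy: "x \<in> B" "y \<in> B" "x \<noteq> y" "\<kappa> x = \<kappa> y"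
    by (auto simp: inj_on_def)
  define D where "D = {z\<in>B. \<kappa> z = \<kappa> x}"
  have D: "D \<subseteq> B" "finite D" "x \<in> D" "y \<in> D" using fin xy by (auto simp: D_def)
  let ?Q = "insert D ((\<lambda>z. D - {z}) ` D)"
  have ne: "D - {z} \<noteq> {}" for z using D xy by blast
  define q :: rat where "q = of_bool (inj_on \<kappa> (B - D))"
  have cD: "card D \<ge> 1" using D by (metis card_gt_0_iff empty_iff Suc_le_eq One_nat_def)
  have "(\<Sum>I\<in>?P. ?t I) = (\<Sum>I\<in>?Q. ?t I)"
  proof (rule sum.mono_neutral_right)
    show "?Q \<subseteq> ?P" using D ne by auto
    show "\<forall>I\<in>?P - ?Q. ?t I = 0"
    proof
      fix I assume I: "I \<in> ?P - ?Q"
      \<comment> \<open>Injectivity off \<open>I\<close> puts \<open>x\<close> or \<open>y\<close>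
        into \<open>I\<close>, so a constant \<open>I\<close> lies in the colour class
        \<open>D\<close>, and at most one vertex of \<open>D\<close> is outside \<open>I\<close>.
        Only \<open>D\<close> and the sets \<open>D - {z}\<close> survive.\<close>
      have False if c: "constant_on_set \<kappa> I" and i: "inj_on \<kappa> (B - I)"
      proof -
        have "x \<in> I \<or> y \<in> I" using i xy by (meson DiffI inj_onD)
        then have ID: "I \<subseteq> D"
          using c I xy unfolding constant_on_set_def D_def by (smt (verit) DiffD1 PowD mem_Collect_eq subset_iff)
        with I obtain z where z: "z \<in> D" "z \<notin> I" by blast
        have "z' = z" if "z' \<in> D" "z' \<notin> I" for z'
          using i z that unfolding D_def inj_on_def by auto
        then have "I = D - {z}" using ID z by blast
        with I z show False by blast
      qed
      then show "?t I = 0" by auto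
    qed
  qed (use fin in auto)
  also have "\<dots> = ?t D + (\<Sum>I\<in>(\<lambda>z. D - {z}) ` D. ?t I)"
    using D by (subst sum.insert) auto
  also have "(\<Sum>I\<in>(\<lambda>z. D - {z}) ` D. ?t I) = (\<Sum>z\<in>D. ?t (D - {z}))"
    by (subst sum.reindex) (auto simp: inj_on_def)
  also have "\<dots> = (\<Sum>z\<in>D. (-1) ^ card D * fact (card D - 1) * q)"
  proof (rule sum.cong)
    fix z assume z: "z \<in> D"
    have "B - (D - {z}) = insert z (B - D)" using z D by blast
    then have "inj_on \<kappa> (B - (D - {z})) \<longleftrightarrow> inj_on \<kappa> (B - D)"
      using z by (auto simp: D_def)
    moreover have "constant_on_set \<kappa> (D - {z})"
      by (auto simp: constant_on_set_def D_def)
    ultimately show "?t (D - {z}) = (-1) ^ card D * fact (card D - 1) * q"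
      using z D cD by (simp add: q_def)
  qed simp
  also have "?t D = (-1) ^ (card D + 1) * fact (card D) * q"
    by (simp add: q_def constant_on_set_def D_def)
  \<comment> \<open>The \<open>card D\<close> sets \<open>D - {z}\<close> together weigh (card D)!,
    with the sign opposite to that of \<open>D\<close>.\<close>
  also have "(-1) ^ (card D + 1) * fact (card D) * q + (\<Sum>z\<in>D. (-1) ^ card D * fact (card D - 1) * q) = 0"
    using cD by (simp add: fact_reduce)
  finally show ?thesis using False by simp
qed


section \<open>Systems of equations and inequations in the span of the e_\<pi>\<close>

abbreviation nc_elems :: "nat \<Rightarrow> ncseries set" where
  "nc_elems d \<equiv> nc_elem d ` {\<sigma>. partition_on {1..d} \<sigma>}"

lemma partition_on_split_block:
  assumes "partition_on A \<tau>" "B \<in> \<tau>" "I \<subseteq> B" "I \<noteq> {}" "I \<noteq> B"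
  shows "partition_on A (insert I (insert (B - I) (\<tau> - {B})))"
proof (rule partition_onI)
  have "I \<union> (B - I \<union> \<Union>(\<tau> - {B})) = B \<union> \<Union>(\<tau> - {B})"
    using \<open>I \<subseteq> B\<close> by blast
  also have "\<dots> = A"
    using partition_onD1[OF assms(1)] \<open>B \<in> \<tau>\<close> by blast
  finally show "\<Union> (insert I (insert (B - I) (\<tau> - {B}))) = A"
    by simp
  have disj: "C \<inter> D = {}" if "C \<in> \<tau>" "D \<in> \<tau>" "C \<noteq> D" for C D
    using that assms by (auto simp: partition_on_def disjoint_def)
  have "C \<inter> I = {}" "C \<inter> (B - I) = {}" if "C \<in> \<tau> - {B}" for C
    using disj[of C B] that \<open>I \<subseteq> B\<close> \<open>B \<in> \<tau>\<close> by blast+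
  then show "disjnt p q" if "p \<in> insert I (insert (B - I) (\<tau> - {B}))"
    "q \<in> insert I (insert (B - I) (\<tau> - {B}))" "p \<noteq> q" for p q
    using that disj[of p q] unfolding disjnt_def by (elim insertE) blast+
  show "{} \<notin> insert I (insert (B - I) (\<tau> - {B}))"
    using assms by (auto simp: partition_on_def)
qed

text \<open>
  Newton's identity is solved for its summand \<open>I = B\<close>; all the others have fewer elements in blocks
  on which the colouring is constant.
\<close>

lemma mixed_in_span:
  assumes "partition_on {1..d} \<tau>" "\<sigma> \<subseteq> \<tau>"
  shows "series_of d (\<lambda>\<kappa>. of_bool ((\<forall>B\<in>\<sigma>. constant_on_set \<kappa> B) \<and> (\<forall>B\<in>\<tau> - \<sigma>. inj_on \<kappa> B)))
           \<in> nc.span (nc_elems d)"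
    (is "series_of d (?f \<sigma> \<tau>) \<in> ?S")
  using assms
proof (induction "card (\<Union>\<sigma>)" arbitrary: \<sigma> \<tau> rule: less_induct)
  case less
  have fin: "finite \<tau>" "finite \<sigma>" "finite (\<Union>\<sigma>)"
    using less.prems finite_elements[of "{1..d}" \<tau>] finite_subset[of "\<Union>\<sigma>" "{1..d}"]
      finite_subset[of \<sigma> \<tau>] by (auto simp: partition_on_def)
  show ?case
  proof (cases "\<sigma> = {}")
    case True
    then have "series_of d (?f \<sigma> \<tau>) = nc_elem d \<tau>"
      using less.prems by (simp add: nc_elem_eq)
    then show ?thesis
      using less.prems by (auto intro: nc.span_base)
  next
    case False
    then obtain B where B: "B \<in> \<sigma>" by blast
    have B': "B \<noteq> {}" "finite B" "B \<in> \<tau>"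
      using B fin less.prems by (auto simp: partition_on_def intro: finite_subset[of B "\<Union>\<sigma>"])
    have disj: "C \<inter> D = {}" if "C \<in> \<tau>" "D \<in> \<tau>" "C \<noteq> D" for C D
      using that less.prems by (auto simp: partition_on_def disjoint_def)
    define R where "R \<kappa> \<longleftrightarrow> (\<forall>C\<in>\<sigma> - {B}. constant_on_set \<kappa> C) \<and> (\<forall>C\<in>\<tau> - \<sigma>. inj_on \<kappa> C)" for \<kappa> :: "nat \<Rightarrow> nat"
    define t :: "nat set \<Rightarrow> (nat \<Rightarrow> nat) \<Rightarrow> rat" where
      "t I \<kappa> = of_bool (constant_on_set \<kappa> I \<and> inj_on \<kappa> (B - I)) * of_bool (R \<kappa>)" for I \<kappa>
    define c :: "nat set \<Rightarrow> rat" where "c I = (-1) ^ (card I + 1) * fact (card I)" for I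
    let ?P = "Pow B - {{}, B}"
    have card_less: "card (\<Union>\<sigma>') < card (\<Union>\<sigma>)" if "\<Union>\<sigma>' \<subset> \<Union>\<sigma>" for \<sigma>'
      using that fin by (simp add: psubset_card_mono)
    have "series_of d (\<lambda>\<kappa>. of_bool (inj_on \<kappa> B) * of_bool (R \<kappa>)) = series_of d (?f (\<sigma> - {B}) \<tau>)"
      unfolding R_def using B B' less.prems
      by (intro series_of_cong) auto
    also have "\<dots> \<in> ?S"
    proof (rule less.hyps)
      have "\<Union>(\<sigma> - {B}) \<inter> B = {}"
        using disj less.prems B by blast
      then show "card (\<Union>(\<sigma> - {B})) < card (\<Union>\<sigma>)"
        using B B' by (intro card_less) blast
    qed (use less.prems in auto)
    finally have 1: "series_of d (\<lambda>\<kappa>. of_bool (inj_on \<kappa> B) * of_bool (R \<kappa>)) \<in> ?S" .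
    have 2: "series_of d (t I) \<in> ?S" if "I \<in> ?P" for I
    proof -
      let ?s = "insert I (\<sigma> - {B})" and ?t = "insert I (insert (B - I) (\<tau> - {B}))"
      \<comment> \<open>A proper nonempty part of \<open>B\<close> is not a block of \<tau>, so
        \<open>?t - ?s\<close> consists exactly of \<open>B - I\<close> and the old injective
        blocks.\<close>
      have nin: "C \<notin> \<tau>" if "C \<subseteq> B" "C \<noteq> {}" "C \<noteq> B" for C
        using disj[of C B] that B' by blast
      have "B - I \<noteq> I" using that by auto
      moreover have "B - I \<notin> \<tau>" "I \<notin> \<tau>" using that nin by auto
      ultimately have "?t - ?s = insert (B - I) (\<tau> - \<sigma>)"
        using B B' less.prems by blast
      then have "series_of d (t I) = series_of d (?f ?s ?t)"
        unfolding R_def t_def by (intro series_of_cong) auto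
      also have "\<dots> \<in> ?S"
      proof (rule less.hyps)
        have "\<Union>(\<sigma> - {B}) \<inter> B = {}"
          using disj less.prems B by blast
        then show "card (\<Union>?s) < card (\<Union>\<sigma>)"
          using B that by (intro card_less) blast
        show "partition_on {1..d} ?t"
          using that less.prems(1) B' by (intro partition_on_split_block) auto
      qed (use less.prems in auto)
      finally show ?thesis .
    qed
    \<comment> \<open>The summand \<open>I = B\<close> has coefficient (card B)! up to sign, so over
      the rationals the identity can be solved for it.\<close>
    have c: "c B \<noteq> 0" by (simp add: c_def)
    have "?f \<sigma> \<tau> \<kappa> = inverse (c B) *
        (of_nat (card B) * (of_bool (inj_on \<kappa> B) * of_bool (R \<kappa>)) - (\<Sum>I\<in>?P. c I * t I \<kappa>))" for \<kappa>
    proof -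
      have "of_nat (card B) * of_bool (inj_on \<kappa> B) * of_bool (R \<kappa>) = (\<Sum>I\<in>Pow B - {{}}. c I * t I \<kappa>)"
        unfolding t_def c_def newton_pointwise[OF \<open>finite B\<close>, symmetric]
        by (simp add: sum_distrib_right mult.assoc)
      also have "Pow B - {{}} = insert B ?P" using B' by auto
      also have "(\<Sum>I\<in>\<dots>. c I * t I \<kappa>) = c B * t B \<kappa> + (\<Sum>I\<in>?P. c I * t I \<kappa>)"
        using B' by (subst sum.insert) auto
      finally have "t B \<kappa> = inverse (c B) *
        (of_nat (card B) * (of_bool (inj_on \<kappa> B) * of_bool (R \<kappa>)) - (\<Sum>I\<in>?P. c I * t I \<kappa>))"
        using c by (simp add: field_simps)
      moreover have "?f \<sigma> \<tau> \<kappa> = t B \<kappa>"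
        unfolding t_def R_def using B by auto
      ultimately show ?thesis by simp
    qed
    then have "series_of d (?f \<sigma> \<tau>) = ncscale (inverse (c B))
        (ncscale (of_nat (card B)) (series_of d (\<lambda>\<kappa>. of_bool (inj_on \<kappa> B) * of_bool (R \<kappa>)))
          - (\<Sum>I\<in>?P. ncscale (c I) (series_of d (t I))))"
      by (simp only: series_of_scale series_of_diff series_of_sum)
    also have "\<dots> \<in> ?S"
      using 1 2 by (intro nc.span_scale nc.span_diff nc.span_sum) auto
    finally show ?thesis .
  qed
qed

text \<open>Two indices are related when the equations in \<open>P\<close> force them to have equal
  colours. This is an equivalence that contains \<open>P\<close>, and a colouring that satisfies
  \<open>P\<close> is constant on its classes, which serve as blocks.\<close>

lemma constant_partition:
  fixes P :: "('a \<times> 'a) set"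
  assumes "P \<subseteq> A \<times> A"
  obtains \<sigma> where "partition_on A \<sigma>"
    "\<And>\<kappa> :: 'a \<Rightarrow> 'b. (\<forall>(i, j)\<in>P. \<kappa> i = \<kappa> j) \<longleftrightarrow> (\<forall>B\<in>\<sigma>. constant_on_set \<kappa> B)"
proof
  let ?r = "{(i, j) \<in> A \<times> A. \<forall>\<kappa> :: 'a \<Rightarrow> 'b. (\<forall>(a, b)\<in>P. \<kappa> a = \<kappa> b) \<longrightarrow> \<kappa> i = \<kappa> j}"
  have eq: "equiv A ?r"
    by (intro equivI refl_onI symI transI) auto
  then show "partition_on A (A // ?r)"
    by (rule partition_on_quotient)
  fix \<kappa> :: "'a \<Rightarrow> 'b"
  show "(\<forall>(i, j)\<in>P. \<kappa> i = \<kappa> j) \<longleftrightarrow> (\<forall>B\<in>A // ?r. constant_on_set \<kappa> B)"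
  proof
    assume P: "\<forall>(i, j)\<in>P. \<kappa> i = \<kappa> j"
    show "\<forall>B\<in>A // ?r. constant_on_set \<kappa> B"
    proof
      fix B assume "B \<in> A // ?r"
      then obtain i where "B = ?r `` {i}" by (rule quotientE)
      with P have "\<kappa> j = \<kappa> i" if "j \<in> B" for j using that by auto
      then show "constant_on_set \<kappa> B" by (simp add: constant_on_set_def)
    qed
  next
    assume R: "\<forall>B\<in>A // ?r. constant_on_set \<kappa> B"
    show "\<forall>(i, j)\<in>P. \<kappa> i = \<kappa> j"
    proof (clarify)
      fix i j assume ij: "(i, j) \<in> P"
      with assms have "(i, j) \<in> ?r" "(i, i) \<in> ?r" "i \<in> A" by auto
      then have "constant_on_set \<kappa> (?r `` {i})" "i \<in> ?r `` {i}" "j \<in> ?r `` {i}"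
        using R quotientI[of i A ?r] by (blast, simp_all)
      then show "\<kappa> i = \<kappa> j"
        unfolding constant_on_set_def by blast
    qed
  qed
qed

text \<open>The indicator of an inequation is 1 minus that of the equation, so by induction each
  inequation is either dropped or turned into an equation. Equations alone say that the colouring is
  constant on the blocks of a partition, which is \<open>mixed_in_span\<close> with \<sigma> =
  \<tau>.\<close>

lemma equations_in_span:
  assumes "finite Q" "P \<subseteq> {1..d} \<times> {1..d}" "Q \<subseteq> {1..d} \<times> {1..d}"
  shows "series_of d (\<lambda>\<kappa>. of_bool ((\<forall>(i, j)\<in>P. \<kappa> i = \<kappa> j) \<and> (\<forall>(i, j)\<in>Q. \<kappa> i \<noteq> \<kappa> j)))
           \<in> nc.span (nc_elems d)"
  using assms
proof (induction Q arbitrary: P rule: finite_induct)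
  case empty
  obtain \<sigma> where \<sigma>: "partition_on {1..d} \<sigma>"
    "\<And>\<kappa> :: nat \<Rightarrow> nat. (\<forall>(i, j)\<in>P. \<kappa> i = \<kappa> j) \<longleftrightarrow> (\<forall>B\<in>\<sigma>. constant_on_set \<kappa> B)"
    using constant_partition[OF empty(1)] by metis
  then show ?case
    using mixed_in_span[OF \<sigma>(1) order_refl] by simp
next
  case (insert q Q)
  let ?f = "\<lambda>P \<kappa>. of_bool ((\<forall>(i, j)\<in>P. \<kappa> i = \<kappa> j) \<and> (\<forall>(i, j)\<in>Q. \<kappa> i \<noteq> \<kappa> j))"
  have "(\<lambda>\<kappa>. of_bool ((\<forall>(i, j)\<in>P. \<kappa> i = \<kappa> j) \<and> (\<forall>(i, j)\<in>insert q Q. \<kappa> i \<noteq> \<kappa> j)))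
      = (\<lambda>\<kappa> :: nat \<Rightarrow> nat. ?f P \<kappa> - ?f (insert q P) \<kappa> :: rat)"
    by (intro ext) (auto simp: case_prod_unfold)
  moreover have "series_of d (?f P) - series_of d (?f (insert q P)) \<in> nc.span (nc_elems d)"
    using insert.prems by (intro nc.span_diff insert.IH) auto
  ultimately show ?case
    by (simp only: series_of_diff)
qed

section \<open>Linear independence of the e_\<pi>\<close>

lemma sum_fun_apply: "(\<Sum>i\<in>I. f i) x = (\<Sum>i\<in>I. f i x)"
  by (induction I rule: infinite_finite_induct) auto

text \<open>Evaluation at the word \<open>w k\<close> reads off the coefficient of
  \<open>v k\<close> in a linear combination.\<close>

lemma independent_dual_family:
  assumes "finite J" "\<And>j k. j \<in> J \<Longrightarrow> k \<in> J \<Longrightarrow> v j (w k) = of_bool (j = k)"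
  shows "inj_on v J" "nc.independent (v ` J)"
proof -
  show inj: "inj_on v J"
    using assms(2) by (intro inj_onI) (metis of_bool_eq_1_iff)
  show "nc.independent (v ` J)"
  proof (rule nc.independent_if_scalars_zero)
    fix f x assume z: "(\<Sum>x\<in>v ` J. ncscale (f x) x) = 0" and "x \<in> v ` J"
    then obtain k where k: "k \<in> J" "x = v k" by blast
    have "(\<Sum>x\<in>v ` J. ncscale (f x) x) (w k) = (\<Sum>j\<in>J. f (v j) * v j (w k))"
      by (subst sum.reindex[OF inj]) (simp add: ncscale_def sum_fun_apply)
    also have "\<dots> = (\<Sum>j\<in>J. if j = k then f (v j) else 0)"
      using assms(2) k by (intro sum.cong) auto
    also have "\<dots> = f x" using k assms(1) by simp
    finally show "f x = 0" using z by simp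
  qed (use assms in auto)
qed

text \<open>A dimension count: the indicators \<open>v \<sigma>\<close> of the colourings with
  colour classes exactly \<sigma> are independent, lie in the span of the e_\<pi>, and are as many
  as the set partitions. So the e_\<pi> can neither coincide nor be dependent.\<close>

lemma nc_elem_basis:
  shows "inj_on (nc_elem d) {\<sigma>. partition_on {1..d} \<sigma>}" "nc.independent (nc_elems d)"
proof -
  let ?J = "{\<sigma>. partition_on {1..d} \<sigma>}"
  have fin: "finite ?J"
    by (rule finitely_many_partition_on) simp
  \<comment> \<open>A canonical colouring with the blocks of \<sigma> as colour classes: each vertex
    gets the least element of its block.\<close>
  define \<kappa> where "\<kappa> \<sigma> = (\<lambda>i\<in>{1..d}. Min (block \<sigma> i))" for \<sigma>
  have Min: "Min (block \<sigma> i) \<in> block \<sigma> i" "block \<sigma> i \<subseteq> {1..d}"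
    if "\<sigma> \<in> ?J" "i \<in> {1..d}" for \<sigma> i
  proof -
    show s: "block \<sigma> i \<subseteq> {1..d}"
      using that block_in[of "{1..d}" \<sigma> i] by (auto simp: partition_on_def)
    show "Min (block \<sigma> i) \<in> block \<sigma> i"
      using that in_block[of "{1..d}" \<sigma> i] finite_subset[OF s] by (intro Min_in) auto
  qed
  have ran: "\<kappa> \<sigma> \<in> {1..d} \<rightarrow>\<^sub>E {1..}" if "\<sigma> \<in> ?J" for \<sigma>
    using Min[OF that] unfolding \<kappa>_def by fastforce
  have ker: "\<kappa> \<sigma> i = \<kappa> \<sigma> j \<longleftrightarrow> block \<sigma> i = block \<sigma> j"
    if "\<sigma> \<in> ?J" "i \<in> {1..d}" "j \<in> {1..d}" for \<sigma> i j
    using Min(1)[OF that(1,2)] Min(1)[OF that(1,3)] that block_eq[of "{1..d}" \<sigma>] block_in[of "{1..d}" \<sigma>]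
    unfolding \<kappa>_def by simp metis
  let ?P = "\<lambda>\<sigma>. {(i, j) \<in> {1..d} \<times> {1..d}. block \<sigma> i = block \<sigma> j}"
  let ?Q = "\<lambda>\<sigma>. {(i, j) \<in> {1..d} \<times> {1..d}. block \<sigma> i \<noteq> block \<sigma> j}"
  define v where "v \<sigma> = series_of d (\<lambda>\<kappa>. of_bool ((\<forall>(i, j)\<in>?P \<sigma>. \<kappa> i = \<kappa> j) \<and> (\<forall>(i, j)\<in>?Q \<sigma>. \<kappa> i \<noteq> \<kappa> j)))" for \<sigma>
  \<comment> \<open>A partition is recovered from its equivalence relation. One inclusion is enough,
    the assumption being symmetric.\<close>
  have sub: "\<sigma> \<subseteq> \<tau>" if "\<sigma> \<in> ?J" "\<tau> \<in> ?J"
    and "\<And>i j. i \<in> {1..d} \<Longrightarrow> j \<in> {1..d} \<Longrightarrow> block \<sigma> i = block \<sigma> j \<longleftrightarrow> block \<tau> i = block \<tau> j" for \<sigma> \<tau>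
  proof
    fix B assume B: "B \<in> \<sigma>"
    with that(1) have "B \<noteq> {}" "B \<subseteq> {1..d}" by (auto simp: partition_on_def)
    then obtain i where i: "i \<in> B" "i \<in> {1..d}" by blast
    have cls: "block \<rho> i = {j\<in>{1..d}. block \<rho> i = block \<rho> j}" if "\<rho> \<in> ?J" for \<rho>
    proof -
      have a: "block \<rho> i = block \<rho> j" "j \<in> {1..d}" if "j \<in> block \<rho> i" for j
        using that Min(2)[OF \<open>\<rho> \<in> ?J\<close> i(2)] \<open>\<rho> \<in> ?J\<close> i(2) block_in[of "{1..d}" \<rho> i] block_eq[of "{1..d}" \<rho>] by auto
      have b: "j \<in> block \<rho> i" if "j \<in> {1..d}" "block \<rho> i = block \<rho> j" for j
        using that in_block[of "{1..d}" \<rho> j] \<open>\<rho> \<in> ?J\<close> by simp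
      show ?thesis
      proof (intro set_eqI iffI)
        show "x \<in> {j\<in>{1..d}. block \<rho> i = block \<rho> j}" if "x \<in> block \<rho> i" for x
          using that by (intro CollectI conjI a)
        show "x \<in> block \<rho> i" if "x \<in> {j\<in>{1..d}. block \<rho> i = block \<rho> j}" for x
          using that by (elim CollectE conjE) (rule b)
      qed
    qed
    have "block \<sigma> i = {j\<in>{1..d}. block \<sigma> i = block \<sigma> j}"
      by (rule cls[OF that(1)])
    also have "\<dots> = {j\<in>{1..d}. block \<tau> i = block \<tau> j}"
      using that(3)[OF i(2)] by (intro Collect_cong) auto
    also have "\<dots> = block \<tau> i"
      by (rule cls[OF that(2), symmetric])
    finally have "block \<sigma> i = block \<tau> i" .
    moreover have "B = block \<sigma> i"
      using block_eq[of "{1..d}" \<sigma> B i] that(1) B i by simp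
    ultimately show "B \<in> \<tau>" using block_in[of "{1..d}" \<tau> i] that(2) i by simp
  qed
  have dual: "v \<sigma> (map (\<kappa> \<tau>) [1..<d + 1]) = of_bool (\<sigma> = \<tau>)" if "\<sigma> \<in> ?J" "\<tau> \<in> ?J" for \<sigma> \<tau>
  proof -
    have "v \<sigma> (map (\<kappa> \<tau>) [1..<d + 1]) = of_bool ((\<forall>(i, j)\<in>?P \<sigma>. \<kappa> \<tau> i = \<kappa> \<tau> j) \<and> (\<forall>(i, j)\<in>?Q \<sigma>. \<kappa> \<tau> i \<noteq> \<kappa> \<tau> j))"
      unfolding v_def by (rule series_of_word) (rule ran[OF that(2)])
    also have "\<dots> = of_bool (\<forall>i\<in>{1..d}. \<forall>j\<in>{1..d}. block \<sigma> i = block \<sigma> j \<longleftrightarrow> block \<tau> i = block \<tau> j)"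
    proof (rule arg_cong[where f = of_bool])
      have "(\<forall>(i, j)\<in>?P \<sigma>. \<kappa> \<tau> i = \<kappa> \<tau> j) \<and> (\<forall>(i, j)\<in>?Q \<sigma>. \<kappa> \<tau> i \<noteq> \<kappa> \<tau> j) \<longleftrightarrow>
          (\<forall>i\<in>{1..d}. \<forall>j\<in>{1..d}. block \<sigma> i = block \<sigma> j \<longleftrightarrow> \<kappa> \<tau> i = \<kappa> \<tau> j)"
        by blast
      also have "\<dots> \<longleftrightarrow> (\<forall>i\<in>{1..d}. \<forall>j\<in>{1..d}. block \<sigma> i = block \<sigma> j \<longleftrightarrow> block \<tau> i = block \<tau> j)"
        using ker[OF that(2)] by (intro ball_cong refl) simp
      finally show "(\<forall>(i, j)\<in>?P \<sigma>. \<kappa> \<tau> i = \<kappa> \<tau> j) \<and> (\<forall>(i, j)\<in>?Q \<sigma>. \<kappa> \<tau> i \<noteq> \<kappa> \<tau> j) \<longleftrightarrow>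
          (\<forall>i\<in>{1..d}. \<forall>j\<in>{1..d}. block \<sigma> i = block \<sigma> j \<longleftrightarrow> block \<tau> i = block \<tau> j)" .
    qed
    also have "\<dots> = of_bool (\<sigma> = \<tau>)"
    proof (intro arg_cong[where f = of_bool] iffI)
      assume "\<forall>i\<in>{1..d}. \<forall>j\<in>{1..d}. block \<sigma> i = block \<sigma> j \<longleftrightarrow> block \<tau> i = block \<tau> j"
      then show "\<sigma> = \<tau>"
        using sub[OF that] sub[OF that(2,1)] by (intro antisym) blast+
    qed auto
    finally show ?thesis .
  qed
  have vi: "inj_on v ?J" "nc.independent (v ` ?J)"
    using independent_dual_family[of ?J v "\<lambda>\<tau>. map (\<kappa> \<tau>) [1..<d + 1]"] fin dual by blast+
  have vspan: "v ` ?J \<subseteq> nc.span (nc_elems d)"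
  proof (clarify, unfold v_def, rule equations_in_span)
    show "finite (?Q \<sigma>)" for \<sigma>
      by (rule finite_subset[of _ "{1..d} \<times> {1..d}"]) auto
  qed auto
  \<comment> \<open>A maximal independent subset \<open>B\<close> of the e_\<pi> spans all
    \<open>v \<sigma>\<close>, whence
    \<open>card ?J \<le> card B \<le> card (nc_elems d) \<le> card ?J\<close>. Equality makes
    \<open>B\<close> the whole family and \<open>nc_elem d\<close> injective.\<close>
  obtain B where B: "B \<subseteq> nc_elems d" "nc.independent B" "nc_elems d \<subseteq> nc.span B"
    using nc.maximal_independent_subset by blast
  have finB: "finite B" using B fin finite_subset by blast
  have "v ` ?J \<subseteq> nc.span B"
    using vspan B(3) by (metis nc.span_mono nc.span_span subset_trans)
  then have "card ?J \<le> card B"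
    using nc.independent_span_bound[OF finB vi(2)] card_image[OF vi(1)] by simp
  moreover have "card B \<le> card (nc_elems d)"
    using B fin by (intro card_mono) auto
  moreover have "card (nc_elems d) \<le> card ?J"
    using fin by (rule card_image_le)
  ultimately have c: "card B = card (nc_elems d)" "card (nc_elems d) = card ?J" by linarith+
  then have "B = nc_elems d" using B fin by (intro card_subset_eq) auto
  with B show "nc.independent (nc_elems d)" by simp
  show "inj_on (nc_elem d) ?J"
    using c(2) fin by (intro eq_card_imp_inj_on) auto
qed

section \<open>The coefficients of Y_G and (e)-positivity\<close>

definition nc_coeff :: "nat \<Rightarrow> nat ugraph \<Rightarrow> nat set set \<Rightarrow> rat" where
  "nc_coeff d G \<pi> = nc.representation (nc_elems d) (chromatic_nc d G) (nc_elem d \<pi>)"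

definition proper_on :: "'a ugraph \<Rightarrow> ('a \<Rightarrow> nat) \<Rightarrow> bool" where
  "proper_on G \<kappa> \<longleftrightarrow> (\<forall>u\<in>verts G. \<forall>v\<in>verts G. {u, v} \<in> edges G \<longrightarrow> \<kappa> u \<noteq> \<kappa> v)"

text \<open>The expansion of Y_G in the basis e_\<pi>, read at the word spelled by \<kappa>. As an
  identity between functions of a colouring it carries over to commuting variables and can be
  multiplied.\<close>

lemma proper_eq_nc_coeff_sum:
  assumes "labelled_graph d G" "\<kappa> \<in> {1..d} \<rightarrow>\<^sub>E {1..}"
  shows "of_bool (proper_on G \<kappa>) =
    (\<Sum>\<pi> | partition_on {1..d} \<pi>. nc_coeff d G \<pi> * of_bool (\<forall>B\<in>\<pi>. inj_on \<kappa> B))"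
proof -
  have V: "verts G = {1..d}" using assms by (simp add: labelled_graph_def)
  let ?J = "{\<sigma>. partition_on {1..d} \<sigma>}"
  have fin: "finite ?J"
    by (rule finitely_many_partition_on) simp
  let ?Q = "{(i, j) \<in> {1..d} \<times> {1..d}. {i, j} \<in> edges G}"
  have Y: "chromatic_nc d G = series_of d (\<lambda>\<kappa>. of_bool (proper_on G \<kappa>))"
    unfolding chromatic_nc_def proper_colourings_def word_sum_eq_series_of[symmetric]
    by (simp add: proper_on_def V)
  \<comment> \<open>Properness is a system of inequations, one for each edge in either order,
    without equations; hence Y_G lies in the span.\<close>
  also have "\<dots> = series_of d (\<lambda>\<kappa>. of_bool ((\<forall>(i, j)\<in>{}. \<kappa> i = \<kappa> j) \<and> (\<forall>(i, j)\<in>?Q. \<kappa> i \<noteq> \<kappa> j)))"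
    unfolding proper_on_def V by (intro series_of_cong arg_cong[where f = of_bool]) blast
  also have "\<dots> \<in> nc.span (nc_elems d)"
    by (intro equations_in_span finite_subset[of ?Q "{1..d} \<times> {1..d}"]) auto
  finally have "(\<Sum>b\<in>nc_elems d. ncscale (nc.representation (nc_elems d) (chromatic_nc d G) b) b) = chromatic_nc d G"
    using fin by (intro nc.sum_representation_eq nc_elem_basis) auto
  then have "chromatic_nc d G = (\<Sum>\<pi>\<in>?J. ncscale (nc_coeff d G \<pi>) (nc_elem d \<pi>))"
    by (subst (asm) sum.reindex[OF nc_elem_basis(1)]) (simp add: nc_coeff_def)
  also have "\<dots> = (\<Sum>\<pi>\<in>?J. series_of d (\<lambda>\<kappa>. nc_coeff d G \<pi> * of_bool (\<forall>B\<in>\<pi>. inj_on \<kappa> B)))"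
    by (intro sum.cong) (simp_all add: nc_elem_eq series_of_scale)
  finally have "chromatic_nc d G (map \<kappa> [1..<d + 1]) =
      series_of d (\<lambda>\<kappa>. \<Sum>\<pi>\<in>?J. nc_coeff d G \<pi> * of_bool (\<forall>B\<in>\<pi>. inj_on \<kappa> B)) (map \<kappa> [1..<d + 1])"
    by (simp add: series_of_sum)
  then show ?thesis
    unfolding Y series_of_word[OF assms(2)] .
qed

text \<open>\<nu> merges all e_\<pi> of one type, so positivity is a condition on these sums and not
  on a single \<open>nc_coeff\<close>.\<close>

lemma paren_e_positive_iff:
  "paren_e_positive d G \<longleftrightarrow>
    (\<forall>k. (\<Sum>\<pi> | partition_on {1..d} \<pi> \<and> partition_type d \<pi> = k. nc_coeff d G \<pi>) \<ge> 0)"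
proof -
  let ?J = "{\<sigma>. partition_on {1..d} \<sigma>}"
  have fin: "finite ?J"
    by (rule finitely_many_partition_on) simp
  have "Poly_Mapping.lookup (nu d (chromatic_nc d G)) k =
      (\<Sum>\<pi>\<in>?J. if partition_type d \<pi> = k then nc_coeff d G \<pi> else 0)" for k
    unfolding nu_def nc_coeff_def[symmetric] by (simp add: lookup_sum lookup_single when_def)
  also have "\<dots> k = (\<Sum>\<pi> | partition_on {1..d} \<pi> \<and> partition_type d \<pi> = k. nc_coeff d G \<pi>)" for k
    using fin by (subst sum.inter_filter[symmetric]) simp_all
  finally show ?thesis
    unfolding paren_e_positive_def by simp
qed

section \<open>The cone of e-positive series\<close>

lemma mscale_add: "mscale c (f + g) = mscale c f + mscale c g"
  and mscale_add_left: "mscale (a + b) f = mscale a f + mscale b f"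
  and mscale_mscale: "mscale a (mscale b f) = mscale (a * b) f"
  and mscale_one [simp]: "mscale 1 f = f"
  and mscale_zero [simp]: "mscale c 0 = 0"
  and mscale_zero_left [simp]: "mscale 0 f = 0"
  by (transfer, simp add: fun_eq_iff algebra_simps)+

lemma mscale_mult: "mscale c f * g = mscale c (f * g)"
  by transfer (simp add: fun_eq_iff sum_distrib_left case_prod_unfold mult.assoc)

lemma mscale_mult_right: "f * mscale c g = mscale c (f * g)"
  by (metis mscale_mult mult.commute)

lemma mscale_sum_left: "mscale (\<Sum>i\<in>I. c i) f = (\<Sum>i\<in>I. mscale (c i) f)"
  by (induction I rule: infinite_finite_induct) (auto simp: mscale_add_left)

lemma sum_const_mscale: "(\<Sum>i\<in>I. f) = mscale (of_nat (card I)) f"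
  by (induction I rule: infinite_finite_induct) (auto simp: mscale_add_left simp del: sum_constant)

lemma mcoeff_sum: "mcoeff (\<Sum>i\<in>I. f i) M = (\<Sum>i\<in>I. mcoeff (f i) M)"
  by (induction I rule: infinite_finite_induct) (auto simp: zero_mseries.rep_eq plus_mseries.rep_eq)

text \<open>Building a series one term at a time gives closure under sums and products by induction,
  without bookkeeping of supports; \<open>e_positive_if_e_cone\<close> returns to finitely supported
  coefficients. The condition on \<open>p\<close> makes it an integer partition.\<close>

inductive_set e_cone :: "mseries set" where
  zero: "0 \<in> e_cone"
| step: "f \<in> e_cone \<Longrightarrow> c \<ge> 0 \<Longrightarrow> 0 \<notin># p \<Longrightarrow> f + mscale c (elem_sym_part p) \<in> e_cone"

lemma e_cone_add:
  assumes "f \<in> e_cone" "g \<in> e_cone"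
  shows "f + g \<in> e_cone"
  using assms(2)
proof (induction g rule: e_cone.induct)
  case (step g c p)
  then show ?case
    using e_cone.step[of "f + g" c p] by (simp add: add.assoc)
qed (use assms in simp)

lemma e_cone_sum: "(\<And>i. i \<in> I \<Longrightarrow> f i \<in> e_cone) \<Longrightarrow> (\<Sum>i\<in>I. f i) \<in> e_cone"
  by (induction I rule: infinite_finite_induct) (auto intro: e_cone_add e_cone.zero)

lemma e_cone_scale: "f \<in> e_cone \<Longrightarrow> c \<ge> 0 \<Longrightarrow> mscale c f \<in> e_cone"
proof (induction f rule: e_cone.induct)
  case (step f a p)
  then show ?case
    by (simp add: mscale_add mscale_mscale e_cone.step)
qed (simp add: e_cone.zero)

lemma elem_sym_part_in_e_cone: "0 \<notin># p \<Longrightarrow> elem_sym_part p \<in> e_cone"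
  using e_cone.step[OF e_cone.zero, of 1 p] by simp

text \<open>e_p e_q = e_(p+q), where the partitions are joined as multisets; the two inductions
  extend this to nonnegative combinations.\<close>

lemma e_cone_mult:
  assumes "f \<in> e_cone" "g \<in> e_cone"
  shows "f * g \<in> e_cone"
  using assms(1)
proof (induction f rule: e_cone.induct)
  case (step f a p)
  have "elem_sym_part p * g \<in> e_cone"
    using assms(2)
  proof (induction g rule: e_cone.induct)
    case (step g b q)
    have "elem_sym_part p * mscale b (elem_sym_part q) = mscale b (elem_sym_part (p + q))"
      by (simp add: elem_sym_part_def mscale_mult_right)
    then show ?case
      using step \<open>0 \<notin># p\<close> by (simp add: distrib_left e_cone.step)
  qed (simp add: e_cone.zero)
  with step show ?case
    by (simp add: distrib_right mscale_mult e_cone_add e_cone_scale)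
qed (simp add: e_cone.zero)

lemma one_in_e_cone: "1 \<in> e_cone"
  using elem_sym_part_in_e_cone[of "{#}"] by (simp add: elem_sym_part_def)

lemma elem_sym_0: "elem_sym 0 = 1"
proof (rule mseries_eqI)
  fix M :: "nat multiset"
  have "{S. S \<subseteq> {1..} \<and> finite S \<and> card S = 0 \<and> mset_set S = M} = (if M = {#} then {{}} else {})"
    by auto
  then show "mcoeff (elem_sym 0) M = mcoeff 1 M"
    by (simp add: elem_sym.rep_eq one_mseries.rep_eq)
qed

text \<open>0 is not allowed as a part, so e_0 = 1 enters as the product over the empty
  partition.\<close>

lemma elem_sym_in_e_cone: "elem_sym i \<in> e_cone"
  using elem_sym_part_in_e_cone[of "{#i#}"]
  by (cases "i = 0") (simp_all add: elem_sym_0 one_in_e_cone elem_sym_part_def)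

lemma e_cone_prod_mset: "(\<And>i. i \<in># p \<Longrightarrow> f i \<in> e_cone) \<Longrightarrow> (\<Prod>i\<in>#p. f i) \<in> e_cone"
  by (induction p) (auto intro: e_cone_mult one_in_e_cone)

lemma e_positive_if_e_cone:
  assumes "chromatic_sym G \<in> e_cone"
  shows "e_positive G"
proof -
  have "\<exists>c :: nat multiset \<Rightarrow>\<^sub>0 rat. (\<forall>p\<in>Poly_Mapping.keys c. 0 \<notin># p) \<and>
        f = (\<Sum>p\<in>Poly_Mapping.keys c. mscale (Poly_Mapping.lookup c p) (elem_sym_part p)) \<and>
        (\<forall>p. Poly_Mapping.lookup c p \<ge> 0)" if "f \<in> e_cone" for f
    using that
  proof (induction f rule: e_cone.induct)
    case zero
    show ?case by (intro exI[of _ 0]) auto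
  next
    case (step f a p)
    then obtain c :: "nat multiset \<Rightarrow>\<^sub>0 rat" where c: "\<forall>p\<in>Poly_Mapping.keys c. 0 \<notin># p"
      "f = (\<Sum>p\<in>Poly_Mapping.keys c. mscale (Poly_Mapping.lookup c p) (elem_sym_part p))"
      "\<forall>p. Poly_Mapping.lookup c p \<ge> 0" by blast
    let ?d = "c + Poly_Mapping.single p a"
    \<comment> \<open>\<open>p\<close> may already be a key of \<open>c\<close>, and may fail to be
      a key of \<open>?d\<close> when \<open>a = 0\<close>, so all sums are compared over
      \<open>?K\<close>, where additional terms vanish.\<close>
    let ?K = "insert p (Poly_Mapping.keys c)"
    have K: "Poly_Mapping.keys ?d \<subseteq> ?K"
      using keys_add[of c "Poly_Mapping.single p a"] by (auto split: if_splits)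
    have "(\<Sum>q\<in>Poly_Mapping.keys ?d. mscale (Poly_Mapping.lookup ?d q) (elem_sym_part q))
        = (\<Sum>q\<in>?K. mscale (Poly_Mapping.lookup ?d q) (elem_sym_part q))"
      using K by (intro sum.mono_neutral_left) (auto simp: in_keys_iff simp del: lookup_add)
    also have "\<dots> = (\<Sum>q\<in>?K. mscale (Poly_Mapping.lookup c q) (elem_sym_part q))
        + (\<Sum>q\<in>?K. if q = p then mscale a (elem_sym_part q) else 0)"
      unfolding sum.distrib[symmetric]
      by (intro sum.cong) (auto simp: lookup_add lookup_single mscale_add_left)
    also have "(\<Sum>q\<in>?K. mscale (Poly_Mapping.lookup c q) (elem_sym_part q)) = f"
      unfolding c(2) by (intro sum.mono_neutral_right) (auto simp: in_keys_iff)
    also have "(\<Sum>q\<in>?K. if q = p then mscale a (elem_sym_part q) else 0) = mscale a (elem_sym_part p)"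
      by simp
    finally show ?case
      using K c step by (intro exI[of _ ?d]) (auto simp: lookup_add lookup_single when_def)
  qed
  with assms show ?thesis unfolding e_positive_def by blast
qed

section \<open>Weighted generating functions of colourings\<close>

text \<open>The counterpart of \<open>series_of\<close> in commuting variables, again linear in the
  weight; the indicator of properness gives the chromatic symmetric function. For finite
  \<open>D\<close> each sum is finite, because a colouring that contributes to \<open>M\<close> uses
  only colours from \<open>M\<close>.\<close>

lift_definition colour_sum :: "'a set \<Rightarrow> (('a \<Rightarrow> nat) \<Rightarrow> rat) \<Rightarrow> mseries"
  is "\<lambda>D f M. \<Sum>\<kappa> | \<kappa> \<in> D \<rightarrow>\<^sub>E {1..} \<and> image_mset \<kappa> (mset_set D) = M. f \<kappa>" .

lemma finite_colourings:
  assumes "finite D"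
  shows "finite {\<kappa>. \<kappa> \<in> D \<rightarrow>\<^sub>E {1..} \<and> image_mset \<kappa> (mset_set D) = M}"
proof (rule finite_subset)
  show "{\<kappa>. \<kappa> \<in> D \<rightarrow>\<^sub>E {1..} \<and> image_mset \<kappa> (mset_set D) = M} \<subseteq> D \<rightarrow>\<^sub>E set_mset M"
    using assms by (auto simp: PiE_iff extensional_def)
qed (use assms in \<open>auto intro: finite_PiE\<close>)

lemma colour_sum_cong:
  "D = D' \<Longrightarrow> (\<And>\<kappa>. \<kappa> \<in> D' \<rightarrow>\<^sub>E {1..} \<Longrightarrow> f \<kappa> = g \<kappa>) \<Longrightarrow> colour_sum D f = colour_sum D' g"
  by (rule mseries_eqI) (auto simp: colour_sum.rep_eq intro!: sum.cong)

lemma colour_sum_scale: "colour_sum D (\<lambda>\<kappa>. c * f \<kappa>) = mscale c (colour_sum D f)"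
  and colour_sum_diff: "colour_sum D (\<lambda>\<kappa>. f \<kappa> - g \<kappa>) = colour_sum D f - colour_sum D g"
  by (transfer, simp add: fun_eq_iff sum_distrib_left sum_subtractf)+

lemma colour_sum_sum: "colour_sum D (\<lambda>\<kappa>. \<Sum>i\<in>I. f i \<kappa>) = (\<Sum>i\<in>I. colour_sum D (f i))"
  by (rule mseries_eqI) (simp add: mcoeff_sum colour_sum.rep_eq sum.swap[of _ I])

text \<open>A colouring of a disjoint union is a pair of colourings, and its monomial is the product
  of theirs. The weights separate since \<open>f\<close> reads only \<open>A\<close> and
  \<open>g\<close> only \<open>B\<close>.\<close>

lemma colour_sum_product:
  assumes fin: "finite A" "finite B" "A \<inter> B = {}"
    and f: "\<And>\<kappa> \<kappa>'. (\<And>x. x \<in> A \<Longrightarrow> \<kappa> x = \<kappa>' x) \<Longrightarrow> f \<kappa> = f \<kappa>'"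
    and g: "\<And>\<kappa> \<kappa>'. (\<And>x. x \<in> B \<Longrightarrow> \<kappa> x = \<kappa>' x) \<Longrightarrow> g \<kappa> = g \<kappa>'"
  shows "colour_sum (A \<union> B) (\<lambda>\<kappa>. f \<kappa> * g \<kappa>) = colour_sum A f * colour_sum B g"
proof (rule mseries_eqI)
  fix M :: "nat multiset"
  let ?C = "\<lambda>D M. {\<kappa>. \<kappa> \<in> D \<rightarrow>\<^sub>E {1..} \<and> image_mset \<kappa> (mset_set D) = M}"
  let ?j = "\<lambda>\<kappa>. ((image_mset \<kappa> (mset_set A), image_mset \<kappa> (mset_set B)), (restrict \<kappa> A, restrict \<kappa> B))"
  let ?i = "\<lambda>((M1 :: nat multiset, M2 :: nat multiset), (\<kappa>1, \<kappa>2)). \<lambda>x. if x \<in> A then \<kappa>1 x else \<kappa>2 x"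
  let ?S = "Sigma {(M1, M2). M1 + M2 = M} (\<lambda>P. ?C A (fst P) \<times> ?C B (snd P))"
  have ms: "mset_set (A \<union> B) = mset_set A + mset_set B"
    using fin by (rule mset_set_Union)
  have im: "image_mset \<kappa> (mset_set D) = image_mset \<kappa>' (mset_set D)"
    if "finite D" "\<And>x. x \<in> D \<Longrightarrow> \<kappa> x = \<kappa>' x" for D and \<kappa> \<kappa>' :: "'a \<Rightarrow> nat"
    using that by (intro image_mset_cong) auto
  have "mcoeff (colour_sum A f * colour_sum B g) M =
      (\<Sum>P | fst P + snd P = M. \<Sum>Q\<in>?C A (fst P) \<times> ?C B (snd P). f (fst Q) * g (snd Q))"
    by (simp add: times_mseries.rep_eq colour_sum.rep_eq sum_product sum.cartesian_product case_prod_unfold)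
  also have "\<dots> = (\<Sum>(P, Q)\<in>?S. f (fst Q) * g (snd Q))"
    using finite_mset_splits[of M] finite_colourings[OF fin(1)] finite_colourings[OF fin(2)]
    unfolding case_prod_unfold
    by (intro sum.Sigma[unfolded case_prod_unfold]) (blast intro: finite_cartesian_product)+
  also have "\<dots> = (\<Sum>\<kappa>\<in>?C (A \<union> B) M. f \<kappa> * g \<kappa>)"
  proof (rule sum.reindex_bij_witness[where i = ?j and j = ?i], goal_cases)
    case (1 q)
    then obtain M1 M2 \<kappa>1 \<kappa>2 where q: "q = ((M1, M2), (\<kappa>1, \<kappa>2))" "\<kappa>1 \<in> ?C A M1" "\<kappa>2 \<in> ?C B M2"
      by auto
    have e: "restrict (?i q) A = \<kappa>1" "restrict (?i q) B = \<kappa>2"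
      using q fin(3) by (auto simp: fun_eq_iff PiE_def extensional_def)
    have "image_mset (?i q) (mset_set A) = image_mset \<kappa>1 (mset_set A)"
      "image_mset (?i q) (mset_set B) = image_mset \<kappa>2 (mset_set B)"
      using fin q by (auto intro!: im)
    with e q show ?case by simp
  next
    case (2 q)
    then obtain M1 M2 \<kappa>1 \<kappa>2 where q: "q = ((M1, M2), (\<kappa>1, \<kappa>2))" "\<kappa>1 \<in> ?C A M1" "\<kappa>2 \<in> ?C B M2" "M1 + M2 = M"
      by auto
    have "image_mset (?i q) (mset_set A) = image_mset \<kappa>1 (mset_set A)"
      "image_mset (?i q) (mset_set B) = image_mset \<kappa>2 (mset_set B)"
      using fin q by (auto intro!: im)
    then have "image_mset (?i q) (mset_set (A \<union> B)) = M"
      using q by (simp add: ms)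
    moreover have "?i q \<in> A \<union> B \<rightarrow>\<^sub>E {1..}"
      using q by (auto simp: PiE_def extensional_def)
    ultimately show ?case by simp
  next
    case (3 \<kappa>)
    then show ?case by (auto simp: fun_eq_iff PiE_def extensional_def)
  next
    case (4 \<kappa>)
    have "image_mset (restrict \<kappa> A) (mset_set A) = image_mset \<kappa> (mset_set A)"
      "image_mset (restrict \<kappa> B) (mset_set B) = image_mset \<kappa> (mset_set B)"
      using fin by (auto intro!: im)
    with 4 show ?case by (auto simp: ms)
  next
    case (5 q)
    then obtain M1 M2 \<kappa>1 \<kappa>2 where q: "q = ((M1, M2), (\<kappa>1, \<kappa>2))"
      by auto
    have "f (?i q) = f \<kappa>1" "g (?i q) = g \<kappa>2"
      using q fin(3) by (auto intro!: f g)
    with q show ?case by simp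
  qed
  finally show "mcoeff (colour_sum (A \<union> B) (\<lambda>\<kappa>. f \<kappa> * g \<kappa>)) M = mcoeff (colour_sum A f * colour_sum B g) M"
    by (simp add: colour_sum.rep_eq)
qed

lemma colour_sum_reindex:
  assumes h: "bij_betw h A B" and fin: "finite A"
    and fg: "\<And>\<kappa>. \<kappa> \<in> B \<rightarrow>\<^sub>E {1..} \<Longrightarrow> f \<kappa> = g (restrict (\<kappa> \<circ> h) A)"
  shows "colour_sum B f = colour_sum A g"
proof (rule mseries_eqI)
  fix M :: "nat multiset"
  let ?C = "\<lambda>D M. {\<kappa>. \<kappa> \<in> D \<rightarrow>\<^sub>E {1..} \<and> image_mset \<kappa> (mset_set D) = M}"
  let ?k = "inv_into A h"
  have hA: "h x \<in> B" "?k (h x) = x" if "x \<in> A" for x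
    using h that by (auto simp: bij_betw_def)
  have kB: "?k y \<in> A" "h (?k y) = y" if "y \<in> B" for y
    using h that by (auto simp: bij_betw_def inv_into_into f_inv_into_f)
  have im: "image_mset (restrict \<kappa> D) (mset_set D) = image_mset \<kappa> (mset_set D)" if "finite D" for D and \<kappa> :: "'c \<Rightarrow> nat"
    using that by (intro image_mset_cong) auto
  have finB: "finite B" using h fin bij_betw_finite by blast
  have A: "mset_set B = image_mset h (mset_set A)"
    using h by (auto simp: bij_betw_def image_mset_mset_set)
  have B: "mset_set A = image_mset ?k (mset_set B)"
    using bij_betw_inv_into[OF h] by (auto simp: bij_betw_def image_mset_mset_set)
  have "(\<Sum>\<kappa>\<in>?C B M. f \<kappa>) = (\<Sum>\<kappa>\<in>?C A M. g \<kappa>)"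
  proof (rule sum.reindex_bij_witness[where i = "\<lambda>\<kappa>. restrict (\<kappa> \<circ> ?k) B" and j = "\<lambda>\<kappa>. restrict (\<kappa> \<circ> h) A"], goal_cases)
    case (1 \<kappa>)
    then show ?case using hA kB by (auto simp: fun_eq_iff PiE_def extensional_def)
  next
    case (2 \<kappa>)
    then have "image_mset (restrict (\<kappa> \<circ> h) A) (mset_set A) = M"
      unfolding im[OF fin] by (simp add: A multiset.map_comp)
    then show ?case using 2 hA by auto
  next
    case (3 \<kappa>)
    then show ?case using hA kB by (auto simp: fun_eq_iff PiE_def extensional_def)
  next
    case (4 \<kappa>)
    then have "image_mset (restrict (\<kappa> \<circ> ?k) B) (mset_set B) = M"
      unfolding im[OF finB] by (simp add: B multiset.map_comp)
    then show ?case using 4 kB by auto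
  next
    case (5 \<kappa>)
    then show ?case by (simp add: fg)
  qed
  then show "mcoeff (colour_sum B f) M = mcoeff (colour_sum A g) M"
    by (simp add: colour_sum.rep_eq)
qed

section \<open>Cliques and their disjoint unions\<close>

definition clique_series :: "nat \<Rightarrow> mseries" where
  "clique_series k = mscale (fact k) (elem_sym k)"

text \<open>The chromatic symmetric function of a complete graph is k! e_k: the monomial
  \<open>M\<close> determines the set \<open>S\<close> of colours, and each \<open>S\<close> of size
  k is attained by k! injective colourings.\<close>

lemma colour_sum_inj_on:
  fixes B :: "'a set"
  assumes "finite B"
  shows "colour_sum B (\<lambda>\<kappa>. of_bool (inj_on \<kappa> B)) = clique_series (card B)"
proof (rule mseries_eqI)
  fix M :: "nat multiset"
  let ?S = "{S. S \<subseteq> {1..} \<and> finite S \<and> card S = card B \<and> mset_set S = M}"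
  let ?C = "{\<kappa>. \<kappa> \<in> B \<rightarrow>\<^sub>E {1..} \<and> image_mset \<kappa> (mset_set B) = M}"
  let ?I = "{\<kappa> \<in> ?C. inj_on \<kappa> B}"
  have "mcoeff (colour_sum B (\<lambda>\<kappa>. of_bool (inj_on \<kappa> B))) M = of_nat (card ?I)"
    using finite_colourings[OF assms, of M] by (simp add: colour_sum.rep_eq sum.inter_filter[symmetric] of_bool_def)
  also have "card ?I = fact (card B) * card ?S"
  proof (cases "?S = {}")
    case True
    moreover have "?I = {}"
    proof (rule ccontr)
      assume "?I \<noteq> {}"
      then obtain \<kappa> where "\<kappa> \<in> ?I" by blast
      then have "\<kappa> ` B \<in> ?S"
        using assms by (auto simp: card_image image_mset_mset_set PiE_iff Suc_le_eq)
      with True show False by blast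
    qed
    ultimately show ?thesis by (simp only: card.empty mult_0_right)
  next
    case False
    then obtain S where S: "S \<subseteq> {1..}" "finite S" "card S = card B" "mset_set S = M" by blast
    have "?S = {S}"
      using S by (auto dest!: arg_cong[where f = set_mset])
    moreover have "?I = {\<kappa> \<in> B \<rightarrow>\<^sub>E S. inj_on \<kappa> B}"
    proof (intro set_eqI iffI)
      fix \<kappa> assume "\<kappa> \<in> ?I"
      then have "mset_set (\<kappa> ` B) = mset_set S" "\<kappa> \<in> B \<rightarrow>\<^sub>E {1..}" "inj_on \<kappa> B"
        using S by (auto simp: image_mset_mset_set)
      then have "\<kappa> ` B = S" using S assms by (metis finite_imageI finite_set_mset_mset_set)
      then show "\<kappa> \<in> {\<kappa> \<in> B \<rightarrow>\<^sub>E S. inj_on \<kappa> B}"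
        using \<open>\<kappa> \<in> B \<rightarrow>\<^sub>E {1..}\<close> \<open>inj_on \<kappa> B\<close> by (auto simp: PiE_iff)
    next
      fix \<kappa> assume k: "\<kappa> \<in> {\<kappa> \<in> B \<rightarrow>\<^sub>E S. inj_on \<kappa> B}"
      then have "\<kappa> ` B = S"
        using S assms by (intro card_subset_eq) (auto simp: card_image)
      with k S show "\<kappa> \<in> ?I"
        by (auto simp: image_mset_mset_set PiE_iff)
    qed
    moreover have "card {\<kappa> \<in> B \<rightarrow>\<^sub>E S. inj_on \<kappa> B} = fact (card B)"
      using card_inj_on_subset_funcset[OF assms S(2) order_refl] S(3)
      by (simp add: fact_prod_rev)
    ultimately show ?thesis by simp
  qed
  finally show "mcoeff (colour_sum B (\<lambda>\<kappa>. of_bool (inj_on \<kappa> B))) M = mcoeff (clique_series (card B)) M"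
    by (simp add: clique_series_def mscale.rep_eq elem_sym.rep_eq)
qed

lemma clique_series_in_e_cone: "clique_series k \<in> e_cone"
  by (simp add: clique_series_def e_cone_scale elem_sym_in_e_cone)

lemma colour_sum_blocks:
  assumes "finite P" "\<And>B. B \<in> P \<Longrightarrow> finite B" "disjoint P"
  shows "colour_sum (\<Union>P) (\<lambda>\<kappa>. of_bool (\<forall>B\<in>P. inj_on \<kappa> B)) = (\<Prod>B\<in>P. clique_series (card B))"
  using assms
proof (induction P rule: finite_induct)
  case empty
  have "colour_sum {} (\<lambda>\<kappa> :: 'a \<Rightarrow> nat. of_bool (inj_on \<kappa> {})) = clique_series 0"
    by (subst colour_sum_inj_on) simp_all
  then show ?case
    by (simp add: clique_series_def elem_sym_0)
next
  case (insert B P)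
  have "colour_sum (\<Union>(insert B P)) (\<lambda>\<kappa>. of_bool (\<forall>B\<in>insert B P. inj_on \<kappa> B))
      = colour_sum (B \<union> \<Union>P) (\<lambda>\<kappa>. of_bool (inj_on \<kappa> B) * of_bool (\<forall>B\<in>P. inj_on \<kappa> B))"
    by (intro colour_sum_cong) auto
  also have "\<dots> = colour_sum B (\<lambda>\<kappa>. of_bool (inj_on \<kappa> B)) * colour_sum (\<Union>P) (\<lambda>\<kappa>. of_bool (\<forall>B\<in>P. inj_on \<kappa> B))"
  proof (rule colour_sum_product)
    show "B \<inter> \<Union>P = {}"
      using insert by (auto simp: disjoint_def)
    fix \<kappa> \<kappa>' :: "'a \<Rightarrow> nat"
    show "of_bool (inj_on \<kappa> B) = (of_bool (inj_on \<kappa>' B) :: rat)" if "\<And>x. x \<in> B \<Longrightarrow> \<kappa> x = \<kappa>' x"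
      using inj_on_cong[of B \<kappa> \<kappa>'] that by simp
    show "of_bool (\<forall>B\<in>P. inj_on \<kappa> B) = (of_bool (\<forall>B\<in>P. inj_on \<kappa>' B) :: rat)" if "\<And>x. x \<in> \<Union>P \<Longrightarrow> \<kappa> x = \<kappa>' x"
    proof (intro arg_cong[where f = of_bool] ball_cong refl inj_on_cong)
      show "\<kappa> x = \<kappa>' x" if "B \<in> P" "x \<in> B" for B x
        using that \<open>\<And>x. x \<in> \<Union>P \<Longrightarrow> \<kappa> x = \<kappa>' x\<close> by blast
    qed
  qed (use insert in auto)
  also have "\<dots> = (\<Prod>B\<in>insert B P. clique_series (card B))"
  proof -
    have "disjoint P"
      using insert.prems(2) by (auto simp: disjoint_def)
    with insert.IH insert.prems(1)
    have "colour_sum (\<Union>P) (\<lambda>\<kappa>. of_bool (\<forall>B\<in>P. inj_on \<kappa> B)) = (\<Prod>B\<in>P. clique_series (card B))"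
      by simp
    then show ?thesis
      using insert.hyps insert.prems(1) by (simp add: colour_sum_inj_on)
  qed
  finally show ?case .
qed

section \<open>Two cliques glued at a vertex\<close>

text \<open>\<open>r\<close> is the common vertex. When it lies outside the disjoint sets
  \<open>A\<close> and \<open>B\<close>, this is \<open>W a b\<close> with \<open>a = card A\<close>
  and \<open>b = card B\<close>, each clique having one vertex more.\<close>

definition glued_cliques :: "'a set \<Rightarrow> 'a set \<Rightarrow> 'a \<Rightarrow> mseries" where
  "glued_cliques A B r = colour_sum (insert r (A \<union> B))
     (\<lambda>\<kappa>. of_bool (inj_on \<kappa> (insert r A) \<and> inj_on \<kappa> (insert r B)))"

lemma glued_cliques_commute: "glued_cliques A B r = glued_cliques B A r"
  unfolding glued_cliques_def by (intro colour_sum_cong) auto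

text \<open>Bijections of \<open>A'\<close> with \<open>A\<close> and of \<open>B'\<close> with
  \<open>B\<close>, extended by sending \<open>r'\<close> to \<open>r\<close>, form an isomorphism
  of glued cliques. This allows the recurrence to move the common vertex.\<close>

lemma glued_cliques_cong_card:
  fixes A B :: "'a set" and A' B' :: "'b set"
  assumes "finite A" "finite B" "A \<inter> B = {}" "r \<notin> A \<union> B"
    and "finite A'" "finite B'" "A' \<inter> B' = {}" "r' \<notin> A' \<union> B'"
    and "card A = card A'" "card B = card B'"
  shows "glued_cliques A B r = glued_cliques A' B' r'"
proof -
  obtain h1 where h1: "bij_betw h1 A' A"
    using assms finite_same_card_bij[of A' A] by auto
  obtain h2 where h2: "bij_betw h2 B' B"
    using assms finite_same_card_bij[of B' B] by auto
  define h where "h x = (if x \<in> A' then h1 x else if x \<in> B' then h2 x else r)" for x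
  have hA: "bij_betw h A' A" using h1 by (rule bij_betw_cong[THEN iffD1, rotated]) (simp add: h_def)
  have "bij_betw h B' B" using h2
    by (rule bij_betw_cong[THEN iffD1, rotated]) (use assms in \<open>auto simp: h_def\<close>)
  then have "bij_betw h (A' \<union> B') (A \<union> B)"
    using hA assms by (intro bij_betw_combine) auto
  moreover have "bij_betw h {r'} {r}" using assms by (auto simp: h_def bij_betw_def)
  ultimately have "bij_betw h ((A' \<union> B') \<union> {r'}) ((A \<union> B) \<union> {r})"
    by (rule bij_betw_combine) (use assms in auto)
  then have h: "bij_betw h (insert r' (A' \<union> B')) (insert r (A \<union> B))" by simp
  have im: "insert r A = h ` insert r' A'" "insert r B = h ` insert r' B'"
    using hA[THEN bij_betw_imp_surj_on] \<open>bij_betw h B' B\<close>[THEN bij_betw_imp_surj_on]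
      \<open>bij_betw h {r'} {r}\<close>[THEN bij_betw_imp_surj_on] by auto
  have inj: "inj_on h (insert r' A')" "inj_on h (insert r' B')"
    using h by (auto simp: bij_betw_def intro: inj_on_subset)
  show ?thesis
    unfolding glued_cliques_def
  proof (rule colour_sum_reindex[OF h])
    fix \<kappa> :: "'a \<Rightarrow> nat"
    let ?k = "restrict (\<kappa> \<circ> h) (insert r' (A' \<union> B'))"
    have "inj_on ?k S \<longleftrightarrow> inj_on (\<kappa> \<circ> h) S" if "S \<subseteq> insert r' (A' \<union> B')" for S
      using that by (intro inj_on_cong) auto
    then have "inj_on ?k (insert r' A') \<longleftrightarrow> inj_on (\<kappa> \<circ> h) (insert r' A')"
      "inj_on ?k (insert r' B') \<longleftrightarrow> inj_on (\<kappa> \<circ> h) (insert r' B')"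
      by blast+
    then show "of_bool (inj_on \<kappa> (insert r A) \<and> inj_on \<kappa> (insert r B)) =
        (of_bool (inj_on ?k (insert r' A') \<and> inj_on ?k (insert r' B')) :: rat)"
      unfolding im comp_inj_on_iff[OF inj(1)] comp_inj_on_iff[OF inj(2)] by simp
  qed (use assms in auto)
qed

text \<open>
  Double counting: for a colouring that is injective on \<open>U\<close> and on \<open>V\<close>, the colours used only on \<open>U\<close>
  outnumber those used only on \<open>V\<close> by \<open>card U - card V\<close>.
\<close>

lemma sum_injective_insert:
  assumes "finite U" "finite V" "inj_on \<kappa> U" "inj_on \<kappa> V" "U \<inter> V = {}"
  shows "(\<Sum>u\<in>U. of_bool (inj_on \<kappa> (insert u V))) - (\<Sum>v\<in>V. of_bool (inj_on \<kappa> (insert v U)))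
    = (of_nat (card U) - of_nat (card V) :: rat)"
proof -
  have count: "(\<Sum>u\<in>U. of_bool (inj_on \<kappa> (insert u V))) = (of_nat (card (\<kappa> ` U - \<kappa> ` V)) :: rat)"
    if "finite U" "inj_on \<kappa> U" "inj_on \<kappa> V" "U \<inter> V = {}" for U V
  proof -
    have "(\<Sum>u\<in>U. of_bool (inj_on \<kappa> (insert u V))) = (\<Sum>u\<in>U. if \<kappa> u \<notin> \<kappa> ` V then 1 else (0 :: rat))"
      using that by (intro sum.cong refl) (auto simp: inj_on_insert)
    also have "\<dots> = of_nat (card {u \<in> U. \<kappa> u \<notin> \<kappa> ` V})"
      using that by (simp add: sum.inter_filter[symmetric])
    also have "card {u \<in> U. \<kappa> u \<notin> \<kappa> ` V} = card (\<kappa> ` {u \<in> U. \<kappa> u \<notin> \<kappa> ` V})"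
      using that by (intro card_image[symmetric]) (auto intro: inj_on_subset)
    also have "\<kappa> ` {u \<in> U. \<kappa> u \<notin> \<kappa> ` V} = \<kappa> ` U - \<kappa> ` V" by auto
    finally show ?thesis .
  qed
  have split: "of_nat (card U) = (of_nat (card (\<kappa> ` U - \<kappa> ` V)) + of_nat (card (\<kappa> ` U \<inter> \<kappa> ` V)) :: rat)"
    if "finite U" "inj_on \<kappa> U" for U V
  proof -
    have "card U = card (\<kappa> ` U - \<kappa> ` V) + card (\<kappa> ` U \<inter> \<kappa> ` V)"
      using that card_image[of \<kappa> U] card_Diff_subset_Int[of "\<kappa> ` U" "\<kappa> ` V"] card_mono[of "\<kappa> ` U" "\<kappa> ` U \<inter> \<kappa> ` V"]
      by simp
    then show ?thesis by simp
  qed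
  show ?thesis
    using count[of U V] count[of V U] split[of U V] split[of V U] assms by (simp only: Int_commute)
qed

text \<open>Consider colourings injective on \<open>insert r A\<close> and on \<open>B\<close>, two
  disjoint cliques. Joining a vertex \<open>u\<close> of the first to the clique \<open>B\<close>
  gives \<open>W a b\<close>, and joining \<open>v\<close> in \<open>B\<close> to the first clique
  gives \<open>W (a + 1) (b - 1)\<close>. By \<open>sum_injective_insert\<close> the numbers of
  admissible \<open>u\<close> and \<open>v\<close> differ by a + 1 - b for each such
  colouring.\<close>

lemma glued_cliques_recurrence:
  assumes fin: "finite A" "finite B" "A \<inter> B = {}" "r \<notin> A \<union> B"
  shows "mscale (of_nat (card A + 1)) (glued_cliques A B r) =
    (\<Sum>v\<in>B. glued_cliques (insert r A) (B - {v}) v) +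
    mscale (of_nat (card A + 1) - of_nat (card B)) (clique_series (card A + 1) * clique_series (card B))"
proof -
  let ?U = "insert r A"
  let ?D = "?U \<union> B"
  let ?inj = "\<lambda>S \<kappa>. of_bool (inj_on \<kappa> S) :: rat"
  have c: "card ?U = card A + 1" using fin by simp
  \<comment> \<open>The condition describes cliques on \<open>?U\<close> and on
    \<open>insert u B\<close>, glued at \<open>u\<close>; their sizes are the same as with
    \<open>r\<close> in place of \<open>u\<close>.\<close>
  have 1: "colour_sum ?D (\<lambda>\<kappa>. ?inj ?U \<kappa> * ?inj (insert u B) \<kappa>) = glued_cliques A B r" if "u \<in> ?U" for u
  proof -
    have "colour_sum ?D (\<lambda>\<kappa>. ?inj ?U \<kappa> * ?inj (insert u B) \<kappa>) = glued_cliques (?U - {u}) B u"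
      unfolding glued_cliques_def using that by (intro colour_sum_cong) (auto simp: insert_absorb)
    also have "\<dots> = glued_cliques A B r"
      using fin that by (intro glued_cliques_cong_card) auto
    finally show ?thesis .
  qed
  have 2: "colour_sum ?D (\<lambda>\<kappa>. ?inj B \<kappa> * ?inj (insert v ?U) \<kappa>) = glued_cliques ?U (B - {v}) v" if "v \<in> B" for v
    unfolding glued_cliques_def using that by (intro colour_sum_cong) (auto simp: insert_absorb)
  have "(\<Sum>u\<in>?U. ?inj ?U \<kappa> * ?inj (insert u B) \<kappa>) - (\<Sum>v\<in>B. ?inj B \<kappa> * ?inj (insert v ?U) \<kappa>)
      = (of_nat (card A + 1) - of_nat (card B)) * (?inj ?U \<kappa> * ?inj B \<kappa>)" for \<kappa> :: "'a \<Rightarrow> nat"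
  proof (cases "inj_on \<kappa> ?U \<and> inj_on \<kappa> B")
    case True
    have "?U \<inter> B = {}" using fin by auto
    then show ?thesis
      using sum_injective_insert[of ?U B \<kappa>] True fin(1,2) c by simp
  next
    case False
    have "?inj ?U \<kappa> * ?inj (insert u B) \<kappa> = 0" for u
      using False inj_on_subset[of \<kappa> "insert u B" B] by auto
    moreover have "?inj B \<kappa> * ?inj (insert v ?U) \<kappa> = 0" for v
      using False inj_on_subset[of \<kappa> "insert v ?U" ?U] by auto
    ultimately show ?thesis using False by auto
  qed
  then have "colour_sum ?D (\<lambda>\<kappa>. (\<Sum>u\<in>?U. ?inj ?U \<kappa> * ?inj (insert u B) \<kappa>) - (\<Sum>v\<in>B. ?inj B \<kappa> * ?inj (insert v ?U) \<kappa>))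
    = colour_sum ?D (\<lambda>\<kappa>. (of_nat (card A + 1) - of_nat (card B)) * (?inj ?U \<kappa> * ?inj B \<kappa>))"
    by simp
  moreover have "colour_sum ?D (\<lambda>\<kappa>. ?inj ?U \<kappa> * ?inj B \<kappa>) = clique_series (card A + 1) * clique_series (card B)"
  proof -
    have "colour_sum ?D (\<lambda>\<kappa>. ?inj ?U \<kappa> * ?inj B \<kappa>) = colour_sum ?U (?inj ?U) * colour_sum B (?inj B)"
    proof (rule colour_sum_product)
      fix \<kappa> \<kappa>' :: "'a \<Rightarrow> nat"
      show "?inj ?U \<kappa> = ?inj ?U \<kappa>'" if "\<And>x. x \<in> ?U \<Longrightarrow> \<kappa> x = \<kappa>' x"
        using inj_on_cong[of ?U \<kappa> \<kappa>'] that by simp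
      show "?inj B \<kappa> = ?inj B \<kappa>'" if "\<And>x. x \<in> B \<Longrightarrow> \<kappa> x = \<kappa>' x"
        using inj_on_cong[of B \<kappa> \<kappa>'] that by simp
    qed (use fin in auto)
    then show ?thesis using fin(1,2) c by (simp only: colour_sum_inj_on finite_insert)
  qed
  ultimately have "(\<Sum>u\<in>?U. glued_cliques A B r) - (\<Sum>v\<in>B. glued_cliques ?U (B - {v}) v)
     = mscale (of_nat (card A + 1) - of_nat (card B)) (clique_series (card A + 1) * clique_series (card B))"
    by (simp only: colour_sum_diff colour_sum_sum colour_sum_scale 1 2 cong: sum.cong)
  then show ?thesis
    unfolding sum_const_mscale c by (simp add: algebra_simps)
qed

text \<open>Induction on \<open>card B\<close> by the recurrence, divided by
  \<open>card A + 1\<close>. Its coefficient a + 1 - b is nonnegative for b \<le> a + 1, a bound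
  that survives passing from (a, b) to (a + 1, b - 1). For b > a + 1 the two cliques trade
  places.\<close>

lemma glued_cliques_in_e_cone:
  assumes "finite A" "finite B" "A \<inter> B = {}" "r \<notin> A \<union> B"
  shows "glued_cliques A B r \<in> e_cone"
proof -
  have *: "glued_cliques A B r \<in> e_cone"
    if "finite A" "finite B" "A \<inter> B = {}" "r \<notin> A \<union> B" "card B \<le> card A + 1" for A B and r :: 'a
    using that
  proof (induction "card B" arbitrary: A B r rule: less_induct)
    case less
    have 1: "glued_cliques (insert r A) (B - {v}) v \<in> e_cone" if "v \<in> B" for v
    proof (rule less.hyps)
      show "card (B - {v}) < card B" using less.prems that by (intro card_Diff1_less)
      then show "card (B - {v}) \<le> card (insert r A) + 1" using less.prems by simp
    qed (use less.prems that in auto)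
    have 2: "(of_nat (card B) :: rat) \<le> of_nat (card A + 1)"
      using less.prems(5) by (rule of_nat_mono)
    have "mscale (of_nat (card A + 1)) (glued_cliques A B r) \<in> e_cone"
      unfolding glued_cliques_recurrence[OF less.prems(1-4)] using 1 2
      by (intro e_cone_add e_cone_sum e_cone_scale e_cone_mult clique_series_in_e_cone) auto
    then have "mscale (1 / of_nat (card A + 1)) (mscale (of_nat (card A + 1)) (glued_cliques A B r)) \<in> e_cone"
      by (rule e_cone_scale) simp
    then show ?case by (simp add: mscale_mscale del: of_nat_Suc of_nat_add)
  qed
  show ?thesis
  proof (cases "card B \<le> card A + 1")
    case False
    then have "glued_cliques B A r \<in> e_cone" using assms by (intro *) auto
    then show ?thesis by (simp add: glued_cliques_commute)
  qed (use assms * in auto)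
qed

section \<open>Concatenation\<close>

definition clique_product :: "nat multiset \<Rightarrow> mseries" where
  "clique_product p = (\<Prod>i\<in>#p. clique_series i)"

text \<open>The series attached to two types: disjoint cliques for the ordinary blocks, two glued
  cliques for the distinguished ones. The sizes \<open>snd k\<close> and \<open>snd l\<close> count
  the glued vertex 0, so the intervals have one element less.\<close>

definition concat_series :: "nat multiset \<times> nat \<Rightarrow> nat multiset \<times> nat \<Rightarrow> mseries" where
  "concat_series k l = clique_product (fst k) * (clique_product (fst l) *
     glued_cliques {1..snd k - 1} {snd k..<snd k + snd l - 1} 0)"

text \<open>The assumption keeps the glued vertex 0 out of the interval that starts at
  \<open>snd k\<close>.\<close>

lemma concat_series_in_e_cone: "snd k \<ge> 1 \<Longrightarrow> concat_series k l \<in> e_cone"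
  unfolding concat_series_def clique_product_def
  by (intro e_cone_mult e_cone_prod_mset clique_series_in_e_cone glued_cliques_in_e_cone) auto

lemma colour_sum_blocks_rooted:
  assumes "partition_on A \<pi>" "finite A" "B0 \<in> \<pi>"
  shows "colour_sum (A - B0) (\<lambda>\<kappa>. of_bool (\<forall>B\<in>\<pi> - {B0}. inj_on \<kappa> B)) =
    clique_product (image_mset card (mset_set (\<pi> - {B0})))"
proof -
  have disj: "disjoint (\<pi> - {B0})" and U: "\<Union>(\<pi> - {B0}) = A - B0"
    using assms by (auto simp: partition_on_def disjoint_def)
  have fin: "finite (\<pi> - {B0})" "\<And>B. B \<in> \<pi> \<Longrightarrow> finite B"
    using assms finite_elements[of A \<pi>] by (auto simp: partition_on_def intro: finite_subset)
  have "colour_sum (\<Union>(\<pi> - {B0})) (\<lambda>\<kappa>. of_bool (\<forall>B\<in>\<pi> - {B0}. inj_on \<kappa> B)) = (\<Prod>B\<in>\<pi> - {B0}. clique_series (card B))"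
    using fin disj by (intro colour_sum_blocks) auto
  then show ?thesis
    unfolding U clique_product_def by (simp add: prod_unfold_prod_mset multiset.map_comp comp_def)
qed

text \<open>As \<open>r\<close> is the only common vertex, the two blocks at \<open>r\<close> meet
  in \<open>r\<close> alone, and no other block of \<pi> meets one of \<rho>. The vertices split
  into \<open>A - P\<close>, \<open>C - R\<close> and \<open>P \<union> R\<close>, and the weight
  splits accordingly.\<close>

lemma colour_sum_glued_partitions:
  assumes \<pi>: "partition_on A \<pi>" "finite A" and \<rho>: "partition_on C \<rho>" "finite C"
    and AC: "A \<inter> C = {r}"
  shows "colour_sum (A \<union> C) (\<lambda>\<kappa>. of_bool (\<forall>B\<in>\<pi>. inj_on \<kappa> B) * of_bool (\<forall>B\<in>\<rho>. inj_on \<kappa> B)) =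
    concat_series (image_mset card (mset_set (\<pi> - {block \<pi> r})), card (block \<pi> r))
      (image_mset card (mset_set (\<rho> - {block \<rho> r})), card (block \<rho> r))"
proof -
  define P where "P = block \<pi> r"
  define R where "R = block \<rho> r"
  have r: "r \<in> A" "r \<in> C" using AC by auto
  have P: "P \<in> \<pi>" "r \<in> P" "P \<subseteq> A" "finite P" and R: "R \<in> \<rho>" "r \<in> R" "R \<subseteq> C" "finite R"
    using \<pi> \<rho> r block_in[of A \<pi> r] in_block[of A \<pi> r] block_in[of C \<rho> r] in_block[of C \<rho> r]
    by (auto simp: P_def R_def partition_on_def intro: finite_subset)
  let ?f = "\<lambda>S \<kappa>. of_bool (\<forall>B\<in>S. inj_on \<kappa> B) :: rat"
  have dep: "?f S \<kappa> = ?f S \<kappa>'" if "\<And>x. x \<in> \<Union>S \<Longrightarrow> \<kappa> x = \<kappa>' x" for S and \<kappa> \<kappa>' :: "nat \<Rightarrow> nat"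
  proof (intro arg_cong[where f = of_bool] ball_cong refl inj_on_cong)
    show "\<kappa> x = \<kappa>' x" if "B \<in> S" "x \<in> B" for B x
      using that \<open>\<And>x. x \<in> \<Union>S \<Longrightarrow> \<kappa> x = \<kappa>' x\<close> by blast
  qed
  have U: "\<Union>(\<pi> - {P}) \<subseteq> A - P" "\<Union>(\<rho> - {R}) \<subseteq> C - R"
  proof -
    have *: "\<Union>(\<sigma> - {D}) \<subseteq> X - D" if "partition_on X \<sigma>" "D \<in> \<sigma>" for D X and \<sigma> :: "nat set set"
    proof (rule Union_least)
      fix E assume "E \<in> \<sigma> - {D}"
      with that have "E \<inter> D = {}" "E \<subseteq> X" by (auto simp: partition_on_def disjoint_def)
      then show "E \<subseteq> X - D" by blast
    qed
    show "\<Union>(\<pi> - {P}) \<subseteq> A - P" "\<Union>(\<rho> - {R}) \<subseteq> C - R"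
      using *[OF \<pi>(1) P(1)] *[OF \<rho>(1) R(1)] .
  qed
  have rest: "insert r ((P - {r}) \<union> (R - {r})) = P \<union> R" "insert r (P - {r}) = P" "insert r (R - {r}) = R"
    using P R by auto
  have cp: "card P \<ge> 1" "card R \<ge> 1"
    using P R card_gt_0_iff[of P] card_gt_0_iff[of R] by (auto simp: Suc_le_eq)
  have "colour_sum (P \<union> R) (?f {P, R}) = glued_cliques (P - {r}) (R - {r}) r"
    unfolding glued_cliques_def rest by (intro colour_sum_cong) auto
  also have "\<dots> = glued_cliques {1..card P - 1} {card P..<card P + card R - 1} 0"
    using P R AC cp by (intro glued_cliques_cong_card) auto
  finally have g: "colour_sum (P \<union> R) (?f {P, R}) = \<dots>" .
  have "A \<union> C = (A - P) \<union> ((C - R) \<union> (P \<union> R))" using P R by blast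
  then have "colour_sum (A \<union> C) (\<lambda>\<kappa>. ?f \<pi> \<kappa> * ?f \<rho> \<kappa>) =
      colour_sum ((A - P) \<union> ((C - R) \<union> (P \<union> R))) (\<lambda>\<kappa>. ?f (\<pi> - {P}) \<kappa> * (?f (\<rho> - {R}) \<kappa> * ?f {P, R} \<kappa>))"
  proof (rule colour_sum_cong)
    fix \<kappa>
    have "(\<forall>B\<in>\<pi>. inj_on \<kappa> B) \<and> (\<forall>B\<in>\<rho>. inj_on \<kappa> B) \<longleftrightarrow>
        (\<forall>B\<in>\<pi> - {P}. inj_on \<kappa> B) \<and> (\<forall>B\<in>\<rho> - {R}. inj_on \<kappa> B) \<and> (\<forall>B\<in>{P, R}. inj_on \<kappa> B)"
      using P(1) R(1) by blast
    then show "?f \<pi> \<kappa> * ?f \<rho> \<kappa> = ?f (\<pi> - {P}) \<kappa> * (?f (\<rho> - {R}) \<kappa> * ?f {P, R} \<kappa>)"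
      by (simp only: of_bool_conj[symmetric])
  qed
  also have "\<dots> = colour_sum (A - P) (?f (\<pi> - {P})) *
      colour_sum ((C - R) \<union> (P \<union> R)) (\<lambda>\<kappa>. ?f (\<rho> - {R}) \<kappa> * ?f {P, R} \<kappa>)"
  proof (rule colour_sum_product)
    have "x = r" if "x \<in> A" "x \<in> C" for x using that AC by blast
    then show "(A - P) \<inter> ((C - R) \<union> (P \<union> R)) = {}" using P(2) R(3) by blast
    fix \<kappa> \<kappa>' :: "nat \<Rightarrow> nat"
    show "?f (\<pi> - {P}) \<kappa> = ?f (\<pi> - {P}) \<kappa>'" if "\<And>x. x \<in> A - P \<Longrightarrow> \<kappa> x = \<kappa>' x"
      using that U(1) by (intro dep) blast
    show "?f (\<rho> - {R}) \<kappa> * ?f {P, R} \<kappa> = ?f (\<rho> - {R}) \<kappa>' * ?f {P, R} \<kappa>'"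
      if e: "\<And>x. x \<in> (C - R) \<union> (P \<union> R) \<Longrightarrow> \<kappa> x = \<kappa>' x"
    proof (rule arg_cong2[where f = "(*)"])
      show "?f (\<rho> - {R}) \<kappa> = ?f (\<rho> - {R}) \<kappa>'"
        using e U(2) by (intro dep) blast
      show "?f {P, R} \<kappa> = ?f {P, R} \<kappa>'"
        using e by (intro dep) blast
    qed
  qed (use \<pi> \<rho> P R in auto)
  also have "colour_sum ((C - R) \<union> (P \<union> R)) (\<lambda>\<kappa>. ?f (\<rho> - {R}) \<kappa> * ?f {P, R} \<kappa>) =
      colour_sum (C - R) (?f (\<rho> - {R})) * colour_sum (P \<union> R) (?f {P, R})"
  proof (rule colour_sum_product)
    have "x = r" if "x \<in> A" "x \<in> C" for x using that AC by blast
    then show "(C - R) \<inter> (P \<union> R) = {}" using P(3) R(2) by blast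
    fix \<kappa> \<kappa>' :: "nat \<Rightarrow> nat"
    show "?f (\<rho> - {R}) \<kappa> = ?f (\<rho> - {R}) \<kappa>'" if "\<And>x. x \<in> C - R \<Longrightarrow> \<kappa> x = \<kappa>' x"
      using that U(2) by (intro dep) blast
    show "?f {P, R} \<kappa> = ?f {P, R} \<kappa>'" if e: "\<And>x. x \<in> P \<union> R \<Longrightarrow> \<kappa> x = \<kappa>' x"
      using e by (intro dep) blast
  qed (use \<pi> \<rho> P R in auto)
  also have "colour_sum (A - P) (?f (\<pi> - {P})) = clique_product (image_mset card (mset_set (\<pi> - {P})))"
    using \<pi> P by (intro colour_sum_blocks_rooted)
  also have "colour_sum (C - R) (?f (\<rho> - {R})) = clique_product (image_mset card (mset_set (\<rho> - {R})))"
    using \<rho> R by (intro colour_sum_blocks_rooted)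
  finally show ?thesis
    unfolding g concat_series_def P_def[symmetric] R_def[symmetric] by simp
qed

text \<open>
  Vertex \<open>j\<close> of \<open>H\<close> sits at \<open>n + m - j\<close> in the concatenation of \<open>G\<close> with the reverse of \<open>H\<close>, so
  vertex \<open>m\<close> becomes the common vertex \<open>n\<close>.
\<close>

lemma colour_sum_concat_partitions:
  assumes \<pi>: "partition_on {1..n} \<pi>" and \<rho>: "partition_on {1..m} \<rho>" and nm: "n \<ge> 1" "m \<ge> 1"
  shows "colour_sum {1..n + m - 1} (\<lambda>\<kappa>. of_bool (\<forall>B\<in>\<pi>. inj_on \<kappa> B) *
      of_bool (\<forall>B\<in>\<rho>. inj_on (\<kappa> \<circ> (\<lambda>j. n + m - j)) B)) =
    concat_series (partition_type n \<pi>) (partition_type m \<rho>)"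
proof -
  let ?t = "\<lambda>j. n + m - j"
  have inj: "inj_on ?t {1..m}" by (rule inj_onI) auto
  have img: "?t ` {1..m} = {n..n + m - 1}"
  proof (intro set_eqI iffI)
    fix x assume "x \<in> {n..n + m - 1}"
    then show "x \<in> ?t ` {1..m}" using nm by (intro image_eqI[of _ _ "n + m - x"]) auto
  qed (use nm in auto)
  have sub: "B \<subseteq> {1..m}" "B \<noteq> {}" if "B \<in> \<rho>" for B
    using \<rho> that by (auto simp: partition_on_def)
  have injB: "inj_on ?t B" if "B \<in> \<rho>" for B
    using inj sub(1)[OF that] by (rule inj_on_subset)
  let ?\<rho> = "(`) ?t ` \<rho>"
  have injI: "inj_on ((`) ?t) \<rho>"
    using inj_on_image[of ?t \<rho>] inj \<rho> by (simp add: partition_on_def)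
  have \<rho>': "partition_on {n..n + m - 1} ?\<rho>"
  proof -
    have "?\<rho> - {{}} = ?\<rho>" using sub by blast
    then show ?thesis using partition_on_inj_image[OF \<rho> inj] unfolding img by simp
  qed
  have m: "m \<in> {1..m}" using nm by simp
  \<comment> \<open>The type of \<rho> singles out the block of \<open>m\<close>, and
    \<open>m\<close> is sent to \<open>n\<close>, so the image of that block is the one at the glued
    vertex.\<close>
  have br: "block ?\<rho> n = ?t ` block \<rho> m"
  proof (rule block_eq[OF \<rho>'])
    show "?t ` block \<rho> m \<in> ?\<rho>" using block_in[OF \<rho> m] by blast
    show "n \<in> ?t ` block \<rho> m" using in_block[OF \<rho> m] by (intro image_eqI[of _ _ m]) auto
  qed
  have diff: "?\<rho> - {?t ` block \<rho> m} = (`) ?t ` (\<rho> - {block \<rho> m})"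
    using injI block_in[OF \<rho> m] by (subst inj_on_image_set_diff[of _ \<rho>]) auto
  have "image_mset card (mset_set (?\<rho> - {block ?\<rho> n})) = image_mset card (image_mset ((`) ?t) (mset_set (\<rho> - {block \<rho> m})))"
    unfolding br diff
    by (rule arg_cong[OF image_mset_mset_set[symmetric, OF inj_on_subset[OF injI]]]) (rule Diff_subset)
  also have "\<dots> = image_mset card (mset_set (\<rho> - {block \<rho> m}))"
    unfolding multiset.map_comp
  proof (rule image_mset_cong)
    fix B assume "B \<in># mset_set (\<rho> - {block \<rho> m})"
    then have "B \<in> \<rho>" using finite_elements[OF _ \<rho>] by simp
    then show "(card \<circ> (`) ?t) B = card B" using card_image[OF injB] by simp
  qed
  finally have type: "image_mset card (mset_set (?\<rho> - {block ?\<rho> n})) = image_mset card (mset_set (\<rho> - {block \<rho> m}))" .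
  have card: "card (block ?\<rho> n) = card (block \<rho> m)"
    unfolding br using injB[OF block_in[OF \<rho> m]] by (rule card_image)
  have "colour_sum {1..n + m - 1} (\<lambda>\<kappa>. of_bool (\<forall>B\<in>\<pi>. inj_on \<kappa> B) * of_bool (\<forall>B\<in>\<rho>. inj_on (\<kappa> \<circ> ?t) B)) =
      colour_sum ({1..n} \<union> {n..n + m - 1}) (\<lambda>\<kappa>. of_bool (\<forall>B\<in>\<pi>. inj_on \<kappa> B) * of_bool (\<forall>B\<in>?\<rho>. inj_on \<kappa> B))"
  proof (intro colour_sum_cong arg_cong2[where f = "(*)"] arg_cong[where f = of_bool] refl)
    show "{1..n + m - 1} = {1..n} \<union> {n..n + m - 1}" using nm by auto
    show "(\<forall>B\<in>\<rho>. inj_on (\<kappa> \<circ> ?t) B) \<longleftrightarrow> (\<forall>B\<in>?\<rho>. inj_on \<kappa> B)" for \<kappa> :: "nat \<Rightarrow> nat"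
      using comp_inj_on_iff[OF injB, of _ \<kappa>] by blast
  qed
  also have "\<dots> = concat_series (partition_type n \<pi>) (partition_type m \<rho>)"
    unfolding partition_type_def type[symmetric] card[symmetric]
    by (rule colour_sum_glued_partitions) (use \<pi> \<rho>' nm in auto)
  finally show ?thesis .
qed

section \<open>Proper colourings of the concatenation\<close>

lemma proper_on_iff_inj_on_edges:
  assumes "graph G"
  shows "proper_on G \<kappa> \<longleftrightarrow> (\<forall>e\<in>edges G. inj_on \<kappa> e)"
proof
  assume p: "proper_on G \<kappa>"
  show "\<forall>e\<in>edges G. inj_on \<kappa> e"
  proof
    fix e assume e: "e \<in> edges G"
    with assms obtain u v where "e = {u, v}" "u \<noteq> v" "u \<in> verts G" "v \<in> verts G"
      unfolding graph_def by (metis card_2_iff insert_subset)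
    then show "inj_on \<kappa> e" using p e by (auto simp: proper_on_def)
  qed
next
  assume e: "\<forall>e\<in>edges G. inj_on \<kappa> e"
  show "proper_on G \<kappa>"
    unfolding proper_on_def
  proof (intro ballI impI)
    fix u v assume uv: "{u, v} \<in> edges G"
    then have "card {u, v} = 2" using assms by (auto simp: graph_def)
    then have "u \<noteq> v" by auto
    moreover have "inj_on \<kappa> {u, v}" using e uv by blast
    ultimately show "\<kappa> u \<noteq> \<kappa> v" by (simp add: inj_on_insert)
  qed
qed

lemma proper_on_cong:
  "(\<And>v. v \<in> verts G \<Longrightarrow> \<kappa> v = \<kappa>' v) \<Longrightarrow> proper_on G \<kappa> \<longleftrightarrow> proper_on G \<kappa>'"
  unfolding proper_on_def by simp

lemma chromatic_sym_eq_colour_sum: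
  assumes "finite (verts G)"
  shows "chromatic_sym G = colour_sum (verts G) (\<lambda>\<kappa>. of_bool (proper_on G \<kappa>))"
proof (rule mseries_eqI)
  fix M
  have "{\<kappa> \<in> proper_colourings G. image_mset \<kappa> (mset_set (verts G)) = M} =
      {\<kappa> \<in> {\<kappa>. \<kappa> \<in> verts G \<rightarrow>\<^sub>E {1..} \<and> image_mset \<kappa> (mset_set (verts G)) = M}. proper_on G \<kappa>}"
    unfolding proper_colourings_def proper_on_def by blast
  then show "mcoeff (chromatic_sym G) M = mcoeff (colour_sum (verts G) (\<lambda>\<kappa>. of_bool (proper_on G \<kappa>))) M"
    using finite_colourings[OF assms, of M]
    by (simp add: chromatic_sym.rep_eq colour_sum.rep_eq of_bool_def sum.inter_filter[symmetric])
qed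

text \<open>The edges of the concatenation are those of \<open>G\<close> and the relabelled ones of
  \<open>H\<close>. Properness is injectivity on edges, so on relabelled edges it is properness on
  \<open>H\<close> of the composed colouring.\<close>

lemma concat_reverse_graph:
  assumes G: "labelled_graph n G" and H: "labelled_graph m H"
  defines "K \<equiv> concat_graph G (reverse_graph H)"
  shows "verts K = {1..n + m - 1}"
    and "proper_on K \<kappa> \<longleftrightarrow> proper_on G \<kappa> \<and> proper_on H (\<kappa> \<circ> (\<lambda>j. n + m - j))"
    and "n \<ge> 1" "m \<ge> 1"
proof -
  let ?t = "\<lambda>j. n + m - j"
  have gG: "graph G" "verts G = {1..n}" and gH: "graph H" "verts H = {1..m}"
    using G H by (auto simp: labelled_graph_def)
  then show nm: "n \<ge> 1" "m \<ge> 1" by (auto simp: graph_def Suc_le_eq intro: gr0I)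
  have "inj_on (\<lambda>i. m + 1 - i) {1..m}" by (rule inj_onI) auto
  then have c: "card ((\<lambda>i. m + 1 - i) ` {1..m}) = m" by (simp add: card_image)
  show v: "verts K = {1..n + m - 1}"
    using gG gH c by (simp add: K_def concat_graph_def reverse_graph_def Let_def)
  have inj: "inj_on ?t {1..m}" by (rule inj_onI) auto
  have eH: "e \<subseteq> {1..m}" "card e = 2" if "e \<in> edges H" for e
    using gH that by (auto simp: graph_def)
  \<comment> \<open>Reversal followed by the shift is n - 1 + (m + 1 - j) = n + m - j; the truncated
    subtractions are exact because n \<ge> 1 and j \<le> m.\<close>
  have "(\<lambda>i. n - 1 + i) ` (\<lambda>i. m + 1 - i) ` e = ?t ` e" if "e \<in> edges H" for e
    unfolding image_image using eH[OF that] nm by (intro image_cong refl) auto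
  then have E: "edges K = edges G \<union> (`) ?t ` edges H"
    using gG gH c unfolding K_def concat_graph_def reverse_graph_def Let_def
    by (simp add: image_image cong: image_cong)
  have "graph K"
    unfolding graph_def v E
  proof (intro conjI ballI)
    fix e assume "e \<in> edges G \<union> (`) ?t ` edges H"
    then have "e \<subseteq> {1..n + m - 1} \<and> card e = 2"
    proof
      assume "e \<in> edges G"
      then have "e \<subseteq> {1..n}" "card e = 2" using gG by (auto simp: graph_def)
      then show ?thesis using nm by fastforce
    next
      assume "e \<in> (`) ?t ` edges H"
      then obtain e' where e': "e = ?t ` e'" "e' \<in> edges H" by blast
      have "inj_on ?t e'" using inj eH(1)[OF e'(2)] by (rule inj_on_subset)
      moreover have "?t j \<in> {1..n + m - 1}" if "j \<in> e'" for j
        using subsetD[OF eH(1)[OF e'(2)] that] nm by auto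
      ultimately show ?thesis using e' eH(2)[OF e'(2)] by (auto simp: card_image)
    qed
    then show "e \<subseteq> {1..n + m - 1}" "card e = 2" by blast+
  qed (use nm in auto)
  moreover have "inj_on \<kappa> (?t ` e) \<longleftrightarrow> inj_on (\<kappa> \<circ> ?t) e" if "e \<in> edges H" for e
    using comp_inj_on_iff[of ?t e \<kappa>] inj_on_subset[OF inj] eH[OF that] by blast
  ultimately show "proper_on K \<kappa> \<longleftrightarrow> proper_on G \<kappa> \<and> proper_on H (\<kappa> \<circ> ?t)"
    using gG(1) gH(1) by (simp add: proper_on_iff_inj_on_edges E ball_Un)
qed

theorem theorem6p5:
  fixes G H :: "nat ugraph" and n m :: nat
  assumes "labelled_graph n G" and "labelled_graph m H"
    and "paren_e_positive n G" and "paren_e_positive m H"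
  shows "e_positive (concat_graph G (reverse_graph H))"
proof (rule e_positive_if_e_cone)
  let ?K = "concat_graph G (reverse_graph H)" and ?t = "\<lambda>j. n + m - j"
  let ?P = "{\<pi>. partition_on {1..n} \<pi>}" and ?R = "{\<rho>. partition_on {1..m} \<rho>}"
  let ?inj = "\<lambda>\<pi> \<kappa>. of_bool (\<forall>B\<in>\<pi>. inj_on \<kappa> B) :: rat"
  note K = concat_reverse_graph[OF assms(1,2)]
  have VG: "verts G = {1..n}" and VH: "verts H = {1..m}"
    using assms by (auto simp: labelled_graph_def)
  have fin: "finite ?P" "finite ?R"
    by (simp_all add: finitely_many_partition_on)
  let ?a = "nc_coeff n G" and ?b = "nc_coeff m H"
  \<comment> \<open>\<open>proper_eq_nc_coeff_sum\<close> concerns colourings of [n], so \<kappa> is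
    restricted; both sides depend only on the colours there.\<close>
  have pG: "of_bool (proper_on G \<kappa>) = (\<Sum>\<pi>\<in>?P. ?a \<pi> * ?inj \<pi> \<kappa>)"
    if "\<kappa> \<in> {1..n + m - 1} \<rightarrow>\<^sub>E {1..}" for \<kappa>
  proof -
    let ?k = "restrict \<kappa> {1..n}"
    have "of_bool (proper_on G \<kappa>) = (of_bool (proper_on G ?k) :: rat)"
      using proper_on_cong[of G \<kappa> ?k] VG by simp
    also have "\<dots> = (\<Sum>\<pi>\<in>?P. ?a \<pi> * ?inj \<pi> ?k)"
      using that K(4) by (intro proper_eq_nc_coeff_sum assms) fastforce
    also have "\<dots> = (\<Sum>\<pi>\<in>?P. ?a \<pi> * ?inj \<pi> \<kappa>)"
    proof (intro sum.cong refl arg_cong2[where f = "(*)"] arg_cong[where f = of_bool] ball_cong inj_on_cong)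
      show "?k x = \<kappa> x" if "\<pi> \<in> ?P" "B \<in> \<pi>" "x \<in> B" for \<pi> B x
        using that by (auto simp: partition_on_def)
    qed
    finally show ?thesis .
  qed
  have pH: "of_bool (proper_on H (\<kappa> \<circ> ?t)) = (\<Sum>\<rho>\<in>?R. ?b \<rho> * ?inj \<rho> (\<kappa> \<circ> ?t))"
    if "\<kappa> \<in> {1..n + m - 1} \<rightarrow>\<^sub>E {1..}" for \<kappa>
  proof -
    let ?k = "restrict (\<kappa> \<circ> ?t) {1..m}"
    have "of_bool (proper_on H (\<kappa> \<circ> ?t)) = (of_bool (proper_on H ?k) :: rat)"
      using proper_on_cong[of H "\<kappa> \<circ> ?t" ?k] VH by simp
    also have "\<dots> = (\<Sum>\<rho>\<in>?R. ?b \<rho> * ?inj \<rho> ?k)"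
    proof (rule proper_eq_nc_coeff_sum[OF assms(2)])
      have "\<kappa> (?t j) \<in> {1..}" if "j \<in> {1..m}" for j
      proof -
        have "?t j \<in> {1..n + m - 1}" using that K(3) by auto
        then show ?thesis using \<open>\<kappa> \<in> {1..n + m - 1} \<rightarrow>\<^sub>E {1..}\<close> by (rule PiE_mem[rotated])
      qed
      then show "?k \<in> {1..m} \<rightarrow>\<^sub>E {1..}" by (intro PiE_I) auto
    qed
    also have "\<dots> = (\<Sum>\<rho>\<in>?R. ?b \<rho> * ?inj \<rho> (\<kappa> \<circ> ?t))"
    proof (intro sum.cong refl arg_cong2[where f = "(*)"] arg_cong[where f = of_bool] ball_cong inj_on_cong)
      show "?k x = (\<kappa> \<circ> ?t) x" if "\<rho> \<in> ?R" "B \<in> \<rho>" "x \<in> B" for \<rho> B x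
        using that by (auto simp: partition_on_def)
    qed
    finally show ?thesis .
  qed
  have "chromatic_sym ?K = colour_sum {1..n + m - 1} (\<lambda>\<kappa>. of_bool (proper_on ?K \<kappa>))"
    using chromatic_sym_eq_colour_sum[of ?K] by (simp add: K(1))
  also have "\<dots> = colour_sum {1..n + m - 1}
      (\<lambda>\<kappa>. \<Sum>(\<pi>, \<rho>)\<in>?P \<times> ?R. (?a \<pi> * ?b \<rho>) * (?inj \<pi> \<kappa> * ?inj \<rho> (\<kappa> \<circ> ?t)))"
  proof (rule colour_sum_cong[OF refl])
    fix \<kappa> :: "nat \<Rightarrow> nat" assume \<kappa>: "\<kappa> \<in> {1..n + m - 1} \<rightarrow>\<^sub>E {1..}"
    \<comment> \<open>Properness on the concatenation is a conjunction, so the two expansions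
      multiply.\<close>
    have "of_bool (proper_on ?K \<kappa>) = of_bool (proper_on G \<kappa>) * (of_bool (proper_on H (\<kappa> \<circ> ?t)) :: rat)"
      unfolding K(2) by simp
    also have "\<dots> = (\<Sum>\<pi>\<in>?P. \<Sum>\<rho>\<in>?R. (?a \<pi> * ?inj \<pi> \<kappa>) * (?b \<rho> * ?inj \<rho> (\<kappa> \<circ> ?t)))"
      unfolding pG[OF \<kappa>] pH[OF \<kappa>] by (rule sum_product)
    also have "\<dots> = (\<Sum>(\<pi>, \<rho>)\<in>?P \<times> ?R. (?a \<pi> * ?b \<rho>) * (?inj \<pi> \<kappa> * ?inj \<rho> (\<kappa> \<circ> ?t)))"
      unfolding sum.cartesian_product by (intro sum.cong refl) (auto simp only: mult_ac)
    finally show "of_bool (proper_on ?K \<kappa>) = \<dots>" .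
  qed
  also have "\<dots> = (\<Sum>(\<pi>, \<rho>)\<in>?P \<times> ?R. mscale (?a \<pi> * ?b \<rho>)
      (colour_sum {1..n + m - 1} (\<lambda>\<kappa>. ?inj \<pi> \<kappa> * ?inj \<rho> (\<kappa> \<circ> ?t))))"
    unfolding case_prod_unfold colour_sum_sum colour_sum_scale ..
  also have "\<dots> = (\<Sum>(\<pi>, \<rho>)\<in>?P \<times> ?R. mscale (?a \<pi> * ?b \<rho>)
      (concat_series (partition_type n \<pi>) (partition_type m \<rho>)))"
    using colour_sum_concat_partitions[OF _ _ K(3,4)] by (intro sum.cong refl) auto
  also have "\<dots> = (\<Sum>\<pi>\<in>?P. \<Sum>\<rho>\<in>?R. mscale (?a \<pi> * ?b \<rho>)
      (concat_series (partition_type n \<pi>) (partition_type m \<rho>)))"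
    by (rule sum.cartesian_product[symmetric])
  \<comment> \<open>Pairs of partitions are grouped by their types. Since
    \<open>concat_series\<close> depends only on these, the coefficients add up to those of y_G and
    y_H, whose signs are given.\<close>
  also have "\<dots> = (\<Sum>k\<in>partition_type n ` ?P. \<Sum>l\<in>partition_type m ` ?R.
      mscale ((\<Sum>\<pi> | \<pi> \<in> ?P \<and> partition_type n \<pi> = k. ?a \<pi>) * (\<Sum>\<rho> | \<rho> \<in> ?R \<and> partition_type m \<rho> = l. ?b \<rho>))
        (concat_series k l))"
  proof -
    have "(\<Sum>\<pi>\<in>?P. \<Sum>\<rho>\<in>?R. mscale (?a \<pi> * ?b \<rho>) (concat_series (partition_type n \<pi>) (partition_type m \<rho>))) =
      (\<Sum>k\<in>partition_type n ` ?P. \<Sum>\<pi> | \<pi> \<in> ?P \<and> partition_type n \<pi> = k.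
       \<Sum>l\<in>partition_type m ` ?R. \<Sum>\<rho> | \<rho> \<in> ?R \<and> partition_type m \<rho> = l.
         mscale (?a \<pi> * ?b \<rho>) (concat_series (partition_type n \<pi>) (partition_type m \<rho>)))"
      using fin by (simp only: sum.image_gen[symmetric])
    also have "\<dots> = (\<Sum>k\<in>partition_type n ` ?P. \<Sum>\<pi> | \<pi> \<in> ?P \<and> partition_type n \<pi> = k.
       \<Sum>l\<in>partition_type m ` ?R. \<Sum>\<rho> | \<rho> \<in> ?R \<and> partition_type m \<rho> = l.
         mscale (?a \<pi> * ?b \<rho>) (concat_series k l))"
      by (intro sum.cong refl) auto
    also have "\<dots> = (\<Sum>k\<in>partition_type n ` ?P. \<Sum>l\<in>partition_type m ` ?R.
       \<Sum>\<pi> | \<pi> \<in> ?P \<and> partition_type n \<pi> = k. \<Sum>\<rho> | \<rho> \<in> ?R \<and> partition_type m \<rho> = l.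
         mscale (?a \<pi> * ?b \<rho>) (concat_series k l))"
      by (intro sum.cong refl sum.swap)
    also have "\<dots> = (\<Sum>k\<in>partition_type n ` ?P. \<Sum>l\<in>partition_type m ` ?R.
      mscale ((\<Sum>\<pi> | \<pi> \<in> ?P \<and> partition_type n \<pi> = k. ?a \<pi>) * (\<Sum>\<rho> | \<rho> \<in> ?R \<and> partition_type m \<rho> = l. ?b \<rho>))
        (concat_series k l))"
      by (intro sum.cong refl) (simp only: sum_product mscale_sum_left)
    finally show ?thesis .
  qed
  also have "\<dots> \<in> e_cone"
  proof (intro e_cone_sum e_cone_scale mult_nonneg_nonneg concat_series_in_e_cone)
    show "0 \<le> (\<Sum>\<pi> | \<pi> \<in> ?P \<and> partition_type n \<pi> = k. ?a \<pi>)" for k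
      unfolding mem_Collect_eq using assms(3)[unfolded paren_e_positive_iff] by (rule spec)
    show "0 \<le> (\<Sum>\<rho> | \<rho> \<in> ?R \<and> partition_type m \<rho> = l. ?b \<rho>)" for l
      unfolding mem_Collect_eq using assms(4)[unfolded paren_e_positive_iff] by (rule spec)
    \<comment> \<open>The block of \<open>n\<close> contains \<open>n\<close>, so its size is
      positive, as \<open>concat_series_in_e_cone\<close> demands.\<close>
    fix k assume "k \<in> partition_type n ` ?P"
    then obtain \<pi> where \<pi>: "partition_on {1..n} \<pi>" "k = partition_type n \<pi>" by blast
    have "n \<in> {1..n}" using K(3) by simp
    then have "n \<in> block \<pi> n" "block \<pi> n \<subseteq> {1..n}"
      using in_block[OF \<pi>(1)] block_in[OF \<pi>(1)] \<pi>(1) by (auto simp: partition_on_def)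
    then have "card (block \<pi> n) > 0" by (metis card_gt_0_iff empty_iff finite_atLeastAtMost finite_subset)
    then show "1 \<le> snd k" by (simp add: \<pi>(2) partition_type_def)
  qed
  finally show "chromatic_sym ?K \<in> e_cone" .
qed

end
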